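(* Let $\widetilde{\mathsf{A}}(t')$ be an $N\times N$ matrix all of whose entries are smooth functions of $t'\in I$, let $\mathsf{A}(t',t)=\widetilde{\mathsf{A}}(t')\Theta(t'-t)$, and let $\boldsymbol{w},\boldsymbol{v}$ be time-independent vectors with $\boldsymbol{w}^H\boldsymbol{v}=1$. Let $$\mathsf{T}_n=\begin{bmatrix}\alpha_0&\delta&&\\ \beta_1&\alpha_1&\ddots&\\ &\ddots&\ddots&\delta\\ &&\beta_{n-1}&\alpha_{n-1}\end{bmatrix}$$ be the tridiagonal matrix obtained by $n$ iterations of the $\ast$-Lanczos algorithm with inputs $\mathsf{A},\boldsymbol{w},\boldsymbol{v}$. Assume that the $\ast$-Lanczos coefficients $\alpha_{j-1},\beta_j$ are in $\mathrm{Sm}_\Theta$ and that $\beta_j(t,t)\equiv0$, for every $j=1,\dots,n-1$. Denote by $\widetilde\beta_j^{(1,0)}(t',t)$ and $\widetilde\beta_j^{(0,1)}(t',t)$ respectively the derivative with respect to $t'$ and $t$ of $\widetilde\beta_j(t',t)$, where $\beta_j(t',t)=\widetilde\beta_j(t',t)\Theta(t'-t)$. Then the following statements are equivalent: 1. $\widetilde\beta_1^{(1,0)}(t,t),\dots,\widetilde\beta_{n-1}^{(1,0)}(t,t)$ are not identically null on $I$; 2. $\widetilde\beta_1^{(0,1)}(t,t),\dots,\widetilde\beta_{n-1}^{(0,1)}(t,t)$ are not identically null on $I$; 3. There exists at least one $\rho\in I$ so that the usual non-Hermitian Lanczos algorithm with inputs $\widetilde{\mathsf{A}}(\rho),\boldsymbol{w},\boldsymbol{v}$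 has no (true) breakdown in the first $n-1$ iterations.
   Context: Time variables $t,t'$ range over an interval $I\subseteq\mathbb{R}$; matrices and vectors are complex; $\boldsymbol{w}^H$ is the Hermitian transpose. $\Theta$ is the Heaviside function with $\Theta(0)=1$; $\delta^{(i)}$ is the $i$th derivative of the Dirac delta distribution $\delta=\delta^{(0)}$; $\delta$ without argument means $\delta(t'-t)$. Class $\mathrm{D}$: distributions of the form $d(t',t)=\widetilde d(t',t)\Theta(t'-t)+\sum_{i=0}^{M}\widetilde d_i(t',t)\delta^{(i)}(t'-t)$ with $M$ finite and $\widetilde d,\widetilde d_i$ ordinary functions smooth in both variables. Subclass $\mathrm{Sm}_\Theta$: those of the form $f(t',t)=\widetilde f(t',t)\Theta(t'-t)$ with $\widetilde f$ smooth in both variables. $\ast$-product: $(f_2\ast f_1)(t',t):=\int_{-\infty}^{\infty}f_2(t',\tau)f_1(\tau,t)\,d\tau$ (in the sense of distributions), with unit $1_\ast=\delta(t'-t)$; for $f_1,f_2\in\mathrm{Sm}_\Theta$ it equals $\Theta(t'-t)\int_t^{t'}\widetilde f_2(t',\tau)\widetilde f_1(\tau,t)\,d\tau$. A function of one variable such as $\widetilde{\mathsf{A}}(t')$ is treated as a function of $(t',t)$ depending only on the left variable. The product extends to matrices and vectors via the ordinary matrix product between the integrands; $\mathsf{M}^{\ast k}$ is the $k$th $\ast$-power. The $\ast$-inverse $f^{\ast-1}$ satisfies $f^{\ast-1}\ast f=f\ast f^{\ast-1}=1_\ast$. $\ast$-Lanczos algorithm with inputs $\mathsf{A},\boldsymbol{w},\boldsymbol{v}$,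 $\boldsymbol{w}^H\boldsymbol{v}=1$. Initialize: $\boldsymbol{v}_{-1}=\boldsymbol{w}_{-1}=0$, $\boldsymbol{v}_0=\boldsymbol{v}\,1_\ast$, $\boldsymbol{w}_0^H=\boldsymbol{w}^H1_\ast$; $\alpha_0=\boldsymbol{w}^H\mathsf{A}\boldsymbol{v}$; $\boldsymbol{w}_1^H=\boldsymbol{w}^H\mathsf{A}-\alpha_0\boldsymbol{w}^H$; $\widehat{\boldsymbol{v}}_1=\mathsf{A}\boldsymbol{v}-\boldsymbol{v}\alpha_0$; $\beta_1=\boldsymbol{w}^H\mathsf{A}^{\ast2}\boldsymbol{v}-\alpha_0^{\ast2}$; if $\beta_1$ is not $\ast$-invertible stop (breakdown), otherwise $\boldsymbol{v}_1=\widehat{\boldsymbol{v}}_1\ast\beta_1^{\ast-1}$. For $m=2,3,\dots$: $\alpha_{m-1}=\boldsymbol{w}_{m-1}^H\ast\mathsf{A}\ast\boldsymbol{v}_{m-1}$; $\boldsymbol{w}_m^H=\boldsymbol{w}_{m-1}^H\ast\mathsf{A}-\alpha_{m-1}\ast\boldsymbol{w}_{m-1}^H-\beta_{m-1}\ast\boldsymbol{w}_{m-2}^H$; $\widehat{\boldsymbol{v}}_m=\mathsf{A}\ast\boldsymbol{v}_{m-1}-\boldsymbol{v}_{m-1}\ast\alpha_{m-1}-\boldsymbol{v}_{m-2}$; $\beta_m=\boldsymbol{w}_m^H\ast\mathsf{A}\ast\boldsymbol{v}_{m-1}$; if $\beta_m$ is not $\ast$-invertible stop (breakdown), otherwise $\boldsymbol{v}_m=\widehat{\boldsymbol{v}}_m\ast\beta_m^{\ast-1}$.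 Usual non-Hermitian Lanczos algorithm with inputs a constant matrix $\mathsf{M}$ and vectors $\boldsymbol{w},\boldsymbol{v}$ with $\boldsymbol{w}^H\boldsymbol{v}=1$: set $\boldsymbol{v}_{-1}=\boldsymbol{w}_{-1}=0$, $\boldsymbol{v}_0=\boldsymbol{v}$, $\boldsymbol{w}_0=\boldsymbol{w}$, and for $k=1,2,\dots$ (with the $\boldsymbol{w}_{-1}$ term absent for $k=1$) compute $a_{k-1}=\boldsymbol{w}_{k-1}^H\mathsf{M}\boldsymbol{v}_{k-1}$, $\boldsymbol{w}_k^H=\boldsymbol{w}_{k-1}^H\mathsf{M}-a_{k-1}\boldsymbol{w}_{k-1}^H-b_{k-1}\boldsymbol{w}_{k-2}^H$, $\widehat{\boldsymbol{v}}_k=\mathsf{M}\boldsymbol{v}_{k-1}-a_{k-1}\boldsymbol{v}_{k-1}-\boldsymbol{v}_{k-2}$, $b_k=\boldsymbol{w}_k^H\mathsf{M}\boldsymbol{v}_{k-1}$, and, if $b_k\neq0$, $\boldsymbol{v}_k=\widehat{\boldsymbol{v}}_k/b_k$. There is no (true) breakdown in the first $n-1$ iterations exactly when $b_1,\dots,b_{n-1}$ are all nonzero, i.e. when the algorithm generates an $n\times n$ tridiagonal matrix with nonzero off-diagonal elements. *)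

theory Defs
  imports "HOL-Analysis.Analysis" "HOL-Library.Function_Algebras"
begin

section \<open>Smoothness on an interval\<close>

text \<open>At an endpoint belonging to \<open>I\<close> all derivatives are one-sided. Intervals are not required to be
  open or bounded.\<close>

primrec nderiv :: "real set \<Rightarrow> nat \<Rightarrow> (real \<Rightarrow> complex) \<Rightarrow> real \<Rightarrow> complex" where
  "nderiv I 0 f = f"
| "nderiv I (Suc k) f = (\<lambda>t. vector_derivative (nderiv I k f) (at t within I))"

definition smooth1 :: "real set \<Rightarrow> (real \<Rightarrow> complex) \<Rightarrow> bool" where
  "smooth1 I f \<longleftrightarrow> (\<forall>k. \<forall>t\<in>I. nderiv I k f differentiable (at t within I))"

definition deriv10 :: "real set \<Rightarrow> (real \<Rightarrow> real \<Rightarrow> complex) \<Rightarrow> real \<Rightarrow> real \<Rightarrow> complex" where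
  "deriv10 I f t' t = vector_derivative (\<lambda>s. f s t) (at t' within I)"

definition deriv01 :: "real set \<Rightarrow> (real \<Rightarrow> real \<Rightarrow> complex) \<Rightarrow> real \<Rightarrow> real \<Rightarrow> complex" where
  "deriv01 I f t' t = vector_derivative (\<lambda>s. f t' s) (at t within I)"

primrec Ck2 :: "real set \<Rightarrow> nat \<Rightarrow> (real \<Rightarrow> real \<Rightarrow> complex) \<Rightarrow> bool" where
  "Ck2 I 0 f \<longleftrightarrow> continuous_on (I \<times> I) (\<lambda>(t', t). f t' t)"
| "Ck2 I (Suc k) f \<longleftrightarrow>
     continuous_on (I \<times> I) (\<lambda>(t', t). f t' t) \<and>
     (\<forall>t'\<in>I. \<forall>t\<in>I. (\<lambda>s. f s t) differentiable (at t' within I)) \<and>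
     (\<forall>t'\<in>I. \<forall>t\<in>I. (\<lambda>s. f t' s) differentiable (at t within I)) \<and>
     Ck2 I k (deriv10 I f) \<and> Ck2 I k (deriv01 I f)"

definition smooth2 :: "real set \<Rightarrow> (real \<Rightarrow> real \<Rightarrow> complex) \<Rightarrow> bool" where
  "smooth2 I f \<longleftrightarrow> (\<forall>k. Ck2 I k f)"


section \<open>Distributions of class D\<close>

text \<open>
  A distribution \<open>d(t',t)\<close> is represented by its action
  \<open>\<phi> \<mapsto> (t' \<mapsto> \<integral> d(t',\<tau>) \<phi>(\<tau>) d\<tau>)\<close> on test functions, i.e. as the operator of which it is the Schwartz
  kernel; the kernel determines the operator and conversely. Test functions are the smooth functions
  on \<open>I\<close> that vanish near the left end of \<open>I\<close>. As members of class D are supported in \<open>t' \<ge> t\<close>, the action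
  at \<open>t'\<close> only sees the test function up to \<open>t'\<close>, so this determines the same distributions as compactly
  supported test functions do; unlike the latter, these test functions are preserved by class D,
  so that actions can be iterated.

  Everything is set to 0 outside its domain (test functions and points of \<open>I\<close>). Two distributions are
  then equal iff the operators are equal in HOL, and \<open>+\<close>, \<open>-\<close>, \<open>0\<close> are the pointwise operations.
\<close>

type_synonym dist = "(real \<Rightarrow> complex) \<Rightarrow> real \<Rightarrow> complex"

definition test_fun :: "real set \<Rightarrow> (real \<Rightarrow> complex) set" where
  "test_fun I = {\<phi>. smooth1 I \<phi> \<and> (\<forall>t. t \<notin> I \<longrightarrow> \<phi> t = 0) \<and>
                    (\<exists>c\<in>interior I. \<forall>t\<le>c. \<phi> t = 0)}"

definition Heaviside :: "real \<Rightarrow> complex" where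
  "Heaviside x = (if x \<ge> 0 then 1 else 0)"

text \<open>
  The distribution \<open>f(t',t) \<Theta>(t'-t) + (\<Sum>i\<le>M. c\<^sub>i(t',t) \<delta>\<^sup>(\<^sup>i\<^sup>)(t'-t))\<close>. The delta terms act by
  \<open>\<integral> c\<^sub>i(t',\<tau>) \<delta>\<^sup>(\<^sup>i\<^sup>)(t'-\<tau>) \<phi>(\<tau>) d\<tau> = \<partial>\<^sub>\<tau>\<^sup>i [c\<^sub>i(t',\<tau>) \<phi>(\<tau>)]\<close> at \<open>\<tau> = t'\<close>; the sign \<open>(-1)\<^sup>i\<close> of the integration
  by parts cancels against the one from \<open>\<tau>\<close> entering \<open>\<delta>\<^sup>(\<^sup>i\<^sup>)(t'-\<tau>)\<close> with a minus.
\<close>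

definition distr :: "real set \<Rightarrow> (real \<Rightarrow> real \<Rightarrow> complex) \<Rightarrow> nat \<Rightarrow>
    (nat \<Rightarrow> real \<Rightarrow> real \<Rightarrow> complex) \<Rightarrow> dist" where
  "distr I f M c = (\<lambda>\<phi> t'. if \<phi> \<in> test_fun I \<and> t' \<in> I
     then integral I (\<lambda>\<tau>. f t' \<tau> * Heaviside (t' - \<tau>) * \<phi> \<tau>)
          + (\<Sum>i\<le>M. nderiv I i (\<lambda>\<tau>. c i t' \<tau> * \<phi> \<tau>) t')
     else 0)"

definition class_D :: "real set \<Rightarrow> dist set" where
  "class_D I = {distr I f M c | f M c. smooth2 I f \<and> (\<forall>i\<le>M. smooth2 I (c i))}"

text \<open>The values of \<open>f(t',t)\<close> for \<open>t' < t\<close> do not matter; by continuity, \<open>theta_distr I f\<close> still determines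
  \<open>f\<close> and its derivatives on the diagonal of \<open>I \<times> I\<close>.\<close>

definition theta_distr :: "real set \<Rightarrow> (real \<Rightarrow> real \<Rightarrow> complex) \<Rightarrow> dist" where
  "theta_distr I f = distr I f 0 (\<lambda>_ _ _. 0)"

definition Sm_Theta :: "real set \<Rightarrow> dist set" where
  "Sm_Theta I = {theta_distr I f | f. smooth2 I f}"

definition delta_const :: "real set \<Rightarrow> complex \<Rightarrow> dist" where
  "delta_const I z = distr I (\<lambda>_ _. 0) 0 (\<lambda>_ _ _. z)"

abbreviation star_one :: "real set \<Rightarrow> dist" where
  "star_one I \<equiv> delta_const I 1"


section \<open>The *-product and *-inverses\<close>

text \<open>
  Integrating \<open>(f\<^sub>2 * f\<^sub>1)(t',t) = \<integral> f\<^sub>2(t',\<tau>) f\<^sub>1(\<tau>,t) d\<tau>\<close> against \<open>\<phi>(t)\<close> gives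
  \<open>\<integral> f\<^sub>2(t',\<tau>) (\<integral> f\<^sub>1(\<tau>,t) \<phi>(t) dt) d\<tau>\<close>: the actions are composed.
\<close>

definition star :: "dist \<Rightarrow> dist \<Rightarrow> dist" (infixl "\<star>" 70) where
  "f2 \<star> f1 = (\<lambda>\<phi>. f2 (f1 \<phi>))"

definition is_star_inverse :: "real set \<Rightarrow> dist \<Rightarrow> dist \<Rightarrow> bool" where
  "is_star_inverse I f g \<longleftrightarrow> g \<in> class_D I \<and> g \<star> f = star_one I \<and> f \<star> g = star_one I"

definition star_invertible :: "real set \<Rightarrow> dist \<Rightarrow> bool" where
  "star_invertible I f \<longleftrightarrow> (\<exists>g. is_star_inverse I f g)"

text \<open>Only meaningful for *-invertible \<open>f\<close>; the inverse is then unique.\<close>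

definition star_inv :: "real set \<Rightarrow> dist \<Rightarrow> dist" where
  "star_inv I f = (THE g. is_star_inverse I f g)"

text \<open>Matrix and vector versions, with symbols patterned after \<open>**\<close>, \<open>v*\<close>, \<open>*v\<close>, \<open>*s\<close>.\<close>

definition star_mm :: "dist^'n^'n \<Rightarrow> dist^'n^'n \<Rightarrow> dist^'n^'n" (infixl "\<star>\<star>" 70) where
  "A \<star>\<star> B = (\<chi> i j. \<Sum>k\<in>UNIV. A $ i $ k \<star> B $ k $ j)"

definition star_vm :: "dist^'n \<Rightarrow> dist^'n^'n \<Rightarrow> dist^'n" (infixl "v\<star>" 70) where
  "x v\<star> A = (\<chi> j. \<Sum>i\<in>UNIV. x $ i \<star> A $ i $ j)"

definition star_mv :: "dist^'n^'n \<Rightarrow> dist^'n \<Rightarrow> dist^'n" (infixr "\<star>v" 70) where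
  "A \<star>v x = (\<chi> i. \<Sum>j\<in>UNIV. A $ i $ j \<star> x $ j)"

definition star_vv :: "dist^'n \<Rightarrow> dist^'n \<Rightarrow> dist" (infix "v\<star>v" 70) where
  "x v\<star>v y = (\<Sum>i\<in>UNIV. x $ i \<star> y $ i)"

definition star_sv :: "dist \<Rightarrow> dist^'n \<Rightarrow> dist^'n" (infixr "\<star>s" 70) where
  "a \<star>s x = (\<chi> i. a \<star> x $ i)"

definition star_vs :: "dist^'n \<Rightarrow> dist \<Rightarrow> dist^'n" (infixl "s\<star>" 70) where
  "x s\<star> a = (\<chi> i. x $ i \<star> a)"

text \<open>A function of one variable depends on the left variable \<open>t'\<close>.\<close>

definition theta_matrix :: "real set \<Rightarrow> (real \<Rightarrow> complex^'n^'n) \<Rightarrow> dist^'n^'n" where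
  "theta_matrix I At = (\<chi> i j. theta_distr I (\<lambda>t' t. At t' $ i $ j))"

definition herm :: "complex^'n \<Rightarrow> complex^'n" where
  "herm x = (\<chi> i. cnj (x $ i))"

definition rowcol :: "complex^'n \<Rightarrow> complex^'n \<Rightarrow> complex" where
  "rowcol x y = (\<Sum>i\<in>UNIV. x $ i * y $ i)"


section \<open>The *-Lanczos algorithm\<close>

text \<open>
  \<open>sl_w m\<close> is the row vector \<open>w\<^sub>m\<^sup>H\<close>. In the initialisation, products with the constant vectors \<open>w\<^sup>H\<close> and \<open>v\<close>
  are *-products with \<open>w\<^sub>0\<^sup>H = w\<^sup>H 1\<^sub>*\<close> and \<open>v\<^sub>0 = v 1\<^sub>*\<close>. There is no coefficient \<open>\<beta>\<^sub>0\<close>; its value is a dummy.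
  \<open>sl_alpha 0\<close> is then \<open>w\<^sup>H A v\<close>, and one equation covers all \<open>\<alpha>\<^sub>m\<close>.
  The functions are total and do not stop; the values \<open>sl_v m\<close> and everything computed from them
  are the algorithm's only if \<open>\<beta>\<^sub>1, \<dots>, \<beta>\<^sub>m\<close> are *-invertible.
\<close>

context
  fixes I :: "real set" and A :: "dist^'n^'n" and w v :: "complex^'n"
begin

function sl_alpha :: "nat \<Rightarrow> dist" and sl_beta :: "nat \<Rightarrow> dist"
  and sl_w :: "nat \<Rightarrow> dist^'n" and sl_v :: "nat \<Rightarrow> dist^'n" where
  "sl_w 0 = (\<chi> i. delta_const I (herm w $ i))"
| "sl_w (Suc 0) = sl_w 0 v\<star> A - sl_alpha 0 \<star>s sl_w 0"
| "sl_w (Suc (Suc m)) =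
     sl_w (Suc m) v\<star> A - sl_alpha (Suc m) \<star>s sl_w (Suc m) - sl_beta (Suc m) \<star>s sl_w m"
| "sl_v 0 = (\<chi> i. delta_const I (v $ i))"
| "sl_v (Suc 0) = (A \<star>v sl_v 0 - sl_v 0 s\<star> sl_alpha 0) s\<star> star_inv I (sl_beta (Suc 0))"
| "sl_v (Suc (Suc m)) =
     (A \<star>v sl_v (Suc m) - sl_v (Suc m) s\<star> sl_alpha (Suc m) - sl_v m)
       s\<star> star_inv I (sl_beta (Suc (Suc m)))"
| "sl_alpha m = (sl_w m v\<star> A) v\<star>v sl_v m"
| "sl_beta 0 = 0"
| "sl_beta (Suc 0) = (sl_w 0 v\<star> (A \<star>\<star> A)) v\<star>v sl_v 0 - sl_alpha 0 \<star> sl_alpha 0"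
| "sl_beta (Suc (Suc m)) = (sl_w (Suc (Suc m)) v\<star> A) v\<star>v sl_v (Suc m)"
  by pat_completeness auto
termination
  by (relation "Wellfounded.measure (\<lambda>x. case x of Inl (Inl m) \<Rightarrow> 4 * m + 3 | Inl (Inr m) \<Rightarrow> 4 * m + 1
        | Inr (Inl m) \<Rightarrow> 4 * m | Inr (Inr m) \<Rightarrow> 4 * m + 2)") auto

end

text \<open>\<open>n\<close> iterations produce \<open>T\<^sub>n\<close>, with entries \<open>\<alpha>\<^sub>0, \<dots>, \<alpha>\<^sub>n\<^sub>-\<^sub>1\<close> and \<open>\<beta>\<^sub>1, \<dots>, \<beta>\<^sub>n\<^sub>-\<^sub>1\<close>; computing
  \<open>\<alpha>\<^sub>n\<^sub>-\<^sub>1\<close> takes the *-inverses of \<open>\<beta>\<^sub>1, \<dots>, \<beta>\<^sub>n\<^sub>-\<^sub>1\<close> but not that of \<open>\<beta>\<^sub>n\<close>.\<close>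

definition star_lanczos_runs ::
    "real set \<Rightarrow> dist^'n^'n \<Rightarrow> complex^'n \<Rightarrow> complex^'n \<Rightarrow> nat \<Rightarrow> bool" where
  "star_lanczos_runs I A w v n \<longleftrightarrow> (\<forall>j\<in>{1..n-1}. star_invertible I (sl_beta I A w v j))"


section \<open>The usual non-Hermitian Lanczos algorithm\<close>

context
  fixes M :: "complex^'n^'n" and w v :: "complex^'n"
begin

function ul_a :: "nat \<Rightarrow> complex" and ul_b :: "nat \<Rightarrow> complex"
  and ul_w :: "nat \<Rightarrow> complex^'n" and ul_v :: "nat \<Rightarrow> complex^'n" where
  "ul_w 0 = herm w"
| "ul_w (Suc 0) = ul_w 0 v* M - ul_a 0 *s ul_w 0"
| "ul_w (Suc (Suc k)) =
     ul_w (Suc k) v* M - ul_a (Suc k) *s ul_w (Suc k) - ul_b (Suc k) *s ul_w k"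
| "ul_v 0 = v"
| "ul_v (Suc 0) = inverse (ul_b (Suc 0)) *s (M *v ul_v 0 - ul_a 0 *s ul_v 0)"
| "ul_v (Suc (Suc k)) = inverse (ul_b (Suc (Suc k))) *s
     (M *v ul_v (Suc k) - ul_a (Suc k) *s ul_v (Suc k) - ul_v k)"
| "ul_a k = rowcol (ul_w k v* M) (ul_v k)"
| "ul_b 0 = 0"
| "ul_b (Suc k) = rowcol (ul_w (Suc k) v* M) (ul_v k)"
  by pat_completeness auto
termination
  by (relation "Wellfounded.measure (\<lambda>x. case x of Inl (Inl m) \<Rightarrow> 4 * m + 3 | Inl (Inr m) \<Rightarrow> 4 * m + 1
        | Inr (Inl m) \<Rightarrow> 4 * m | Inr (Inr m) \<Rightarrow> 4 * m + 2)") auto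

end

definition no_lanczos_breakdown ::
    "complex^'n^'n \<Rightarrow> complex^'n \<Rightarrow> complex^'n \<Rightarrow> nat \<Rightarrow> bool" where
  "no_lanczos_breakdown M w v m \<longleftrightarrow> (\<forall>k\<in>{1..m}. ul_b M w v k \<noteq> 0)"

end

theory Submission
  imports Defs
begin

text \<open>
  Let \<open>D\<close> be differentiation and \<open>J = D\<^sup>-\<^sup>1\<close> integration on test functions. Multiplications and Volterra
  operators with smooth kernels generate an algebra \<open>Z\<close>, and conjugation by \<open>D\<close> preserves it. Every
  distribution occurring in the algorithm is of the form \<open>R D\<^sup>k\<close> with \<open>R \<in> Z\<close>. Its principal symbol, the
  multiplication part of \<open>R\<close>, is a function of one variable; symbols are unique and multiplicative.
  Since \<open>\<beta>\<^sub>j\<close> vanishes on the diagonal, it has order \<open>-2\<close> and symbol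
  \<open>f\<^sub>j(t) = \<beta>\<^sub>j\<^sup>(\<^sup>1\<^sup>,\<^sup>0\<^sup>)(t,t) = - \<beta>\<^sub>j\<^sup>(\<^sup>0\<^sup>,\<^sup>1\<^sup>)(t,t)\<close>. A *-inverse of \<open>\<beta>\<^sub>j\<close> has, wherever \<open>f\<^sub>j \<noteq> 0\<close>,
  order 2 and second-order coefficient \<open>q = 1/f\<^sub>j\<close>. So the continuous function \<open>q f\<^sub>j\<close> takes only the values 0
  and 1, and \<open>f\<^sub>j\<close> either vanishes identically or has no zero at all. In the second case the
  *-inverse has order 2 and symbol \<open>1/f\<^sub>j\<close>, so that taking symbols turns the *-Lanczos recursion into the
  usual one for \<open>A(t)\<close>, simultaneously for all \<open>t\<close>, and \<open>b\<^sub>j = f\<^sub>j\<close>.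
\<close>


section \<open>Smooth functions on an interval\<close>

text \<open>\<open>nderiv\<close> adds derivatives on the outside. Taking the extra one first, on
  the inside, lets inductions on the order generalise over the function.\<close>

lemma nderiv_Suc_shift: "nderiv I k (\<lambda>t. vector_derivative f (at t within I)) = nderiv I (Suc k) f"
  by (induction k) auto

primrec Ck1 :: "real set \<Rightarrow> nat \<Rightarrow> (real \<Rightarrow> complex) \<Rightarrow> bool" where
  "Ck1 I 0 f \<longleftrightarrow> True"
| "Ck1 I (Suc k) f \<longleftrightarrow> (\<forall>t\<in>I. f differentiable (at t within I)) \<and>
     Ck1 I k (\<lambda>t. vector_derivative f (at t within I))"

lemma Ck1_iff_nderiv: "Ck1 I k f \<longleftrightarrow> (\<forall>j<k. \<forall>t\<in>I. nderiv I j f differentiable (at t within I))"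
proof (induction k arbitrary: f)
  case 0 then show ?case by simp
next
  case (Suc k)
  show ?case
    unfolding Ck1.simps Suc.IH nderiv_Suc_shift All_less_Suc2
    by simp
qed

lemma smooth1_iff_Ck1: "smooth1 I f \<longleftrightarrow> (\<forall>k. Ck1 I k f)"
  unfolding smooth1_def Ck1_iff_nderiv by blast

lemma smooth1_deriv: "smooth1 I f \<Longrightarrow> smooth1 I (\<lambda>t. vector_derivative f (at t within I))"
  unfolding smooth1_iff_Ck1 using Ck1.simps(2) by blast

lemma smooth1_differentiable: "smooth1 I f \<Longrightarrow> t \<in> I \<Longrightarrow> f differentiable (at t within I)"
  unfolding smooth1_iff_Ck1 using Ck1.simps(2) by blast

lemma smooth1_has_vector_derivative:
  "smooth1 I f \<Longrightarrow> t \<in> I \<Longrightarrow>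
    (f has_vector_derivative vector_derivative f (at t within I)) (at t within I)"
  using smooth1_differentiable vector_derivative_works by blast

lemma smooth1_continuous_on: "smooth1 I f \<Longrightarrow> continuous_on I f"
  by (meson continuous_on_eq_continuous_within differentiable_imp_continuous_within smooth1_differentiable)

lemma smooth2_deriv10: "smooth2 I K \<Longrightarrow> smooth2 I (deriv10 I K)"
  and smooth2_deriv01: "smooth2 I K \<Longrightarrow> smooth2 I (deriv01 I K)"
  and smooth2_continuous_on: "smooth2 I K \<Longrightarrow> continuous_on (I \<times> I) (\<lambda>(t', t). K t' t)"
proof -
  assume "smooth2 I K"
  then have "Ck2 I (Suc k) K" for k
    unfolding smooth2_def by blast
  then show "smooth2 I (deriv10 I K)" "smooth2 I (deriv01 I K)"
    and "continuous_on (I \<times> I) (\<lambda>(t', t). K t' t)"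
    unfolding smooth2_def Ck2.simps by blast+
qed

lemma smooth2_has_vector_derivative10:
  assumes "smooth2 I K" "t' \<in> I" "t \<in> I"
  shows "((\<lambda>s. K s t) has_vector_derivative deriv10 I K t' t) (at t' within I)"
proof -
  have "Ck2 I (Suc 0) K"
    using assms(1) unfolding smooth2_def by blast
  then show ?thesis
    using assms(2,3) unfolding deriv10_def by (simp add: vector_derivative_works[symmetric])
qed

lemma smooth2_has_vector_derivative01:
  assumes "smooth2 I K" "t' \<in> I" "t \<in> I"
  shows "((\<lambda>s. K t' s) has_vector_derivative deriv01 I K t' t) (at t within I)"
proof -
  have "Ck2 I (Suc 0) K"
    using assms(1) unfolding smooth2_def by blast
  then show ?thesis
    using assms(2,3) unfolding deriv01_def by (simp add: vector_derivative_works[symmetric])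
qed

lemma smooth2_continuous_on_slice:
  assumes "smooth2 I K" "x \<in> I" "S \<subseteq> I"
  shows "continuous_on S (K x)"
proof -
  have "continuous_on S (\<lambda>y. (\<lambda>(t', t). K t' t) (x, y))"
    by (rule continuous_on_compose2[OF smooth2_continuous_on[OF assms(1)]])
       (use assms in \<open>auto intro: continuous_on_Pair continuous_on_const continuous_on_id\<close>)
  then show ?thesis
    by simp
qed

text \<open>Chain rule for s |-> (s, s). Total differentiability at (t, t) follows from one partial
  derivative at that point and continuity of the other. X and Y may differ because Y will be the
  part of I to the right of a cut-off, while the first argument keeps ranging over I.\<close>

lemma has_vector_derivative_diag:
  fixes f :: "real \<Rightarrow> real \<Rightarrow> complex"
  assumes fx: "((\<lambda>s. f s t) has_vector_derivative dx) (at t within X)"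
    and fy: "\<And>x y. x \<in> X \<Longrightarrow> y \<in> Y \<Longrightarrow> (f x has_vector_derivative dy x y) (at y within Y)"
    and cont: "continuous_on (X \<times> Y) (\<lambda>(x, y). dy x y)"
    and t: "t \<in> X" "t \<in> Y" and Y: "convex Y" "Y \<subseteq> X"
  shows "((\<lambda>s. f s s) has_vector_derivative dx + dy t t) (at t within Y)"
proof -
  have "((\<lambda>(x, y). f x y) has_derivative
      (\<lambda>(tx, ty). tx *\<^sub>R dx + blinfun_apply (blinfun_scaleR_left (dy t t)) ty)) (at (t, t) within X \<times> Y)"
  proof (rule has_derivative_partialsI[where fx = "\<lambda>x. x *\<^sub>R dx"
        and fy = "\<lambda>x y. blinfun_scaleR_left (dy x y)"])
    show "((\<lambda>x. f x t) has_derivative (\<lambda>x. x *\<^sub>R dx)) (at t within X)"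
      using fx by (simp add: has_vector_derivative_def)
    show "(f x has_derivative blinfun_apply (blinfun_scaleR_left (dy x y))) (at y within Y)"
      if "x \<in> X" "y \<in> Y" for x y
      using fy[OF that] by (simp add: has_vector_derivative_def)
    have "continuous_on (X \<times> Y) (\<lambda>z. blinfun_scaleR_left (dy (fst z) (snd z)))"
      using cont by (intro continuous_intros) (simp add: case_prod_unfold)
    then show "continuous (at (t, t) within X \<times> Y) (\<lambda>(x, y). blinfun_scaleR_left (dy x y))"
      using t by (simp add: case_prod_unfold continuous_on_eq_continuous_within)
  qed (use t Y in auto)
  then have D: "((\<lambda>z. f (fst z) (snd z)) has_derivative (\<lambda>z. fst z *\<^sub>R dx + snd z *\<^sub>R dy t t))
       (at (t, t) within X \<times> Y)"
    by (simp add: case_prod_unfold)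
  have "((\<lambda>s. (s, s)) has_derivative (\<lambda>s. (s, s))) (at t within Y)"
    by (intro has_derivative_Pair has_derivative_ident)
  from has_derivative_in_compose[OF this has_derivative_subset[OF D]] Y(2)
  have "((\<lambda>s. f s s) has_derivative (\<lambda>s. s *\<^sub>R dx + s *\<^sub>R dy t t)) (at t within Y)"
    by (auto simp: image_subset_iff)
  then show ?thesis
    by (simp add: has_vector_derivative_def scaleR_add_right)
qed

locale time_interval =
  fixes I :: "real set"
  assumes interval: "is_interval I"
    and nondegenerate: "\<exists>a\<in>I. \<exists>b\<in>I. a < b"
begin

lemma convex_I: "convex I"
  using interval is_interval_convex by blast

lemma atLeastAtMost_subset_I: "a \<in> I \<Longrightarrow> b \<in> I \<Longrightarrow> {a..b} \<subseteq> I"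
  using interval by (meson atLeastAtMost_iff mem_is_interval_1_I subsetI)

text \<open>A connected set with two points has no isolated points. This makes derivatives within I
  unique, endpoints included.\<close>

lemma at_within_I_neq_bot: "t \<in> I \<Longrightarrow> at t within I \<noteq> bot"
  using connected_imp_perfect[of I t] nondegenerate convex_connected[OF convex_I]
  by (metis order_less_irrefl singletonD trivial_limit_within)

lemma vector_derivative_within_I:
  "(f has_vector_derivative d) (at t within I) \<Longrightarrow> t \<in> I \<Longrightarrow> vector_derivative f (at t within I) = d"
  by (simp add: at_within_I_neq_bot vector_derivative_within)

lemma differentiable_within_cong:
  assumes "\<And>s. s \<in> S \<Longrightarrow> f s = g s" "t \<in> S"
  shows "f differentiable (at t within S) \<longleftrightarrow> g differentiable (at t within S)"
  using differentiable_transform_within[of f t S 1 g] differentiable_transform_within[of g t S 1 f] assms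
  by auto

lemma Ck1_cong:
  assumes "\<And>t. t \<in> I \<Longrightarrow> f t = g t"
  shows "Ck1 I k f = Ck1 I k g"
  using assms
proof (induction k arbitrary: f g)
  case (Suc k)
  have "f differentiable (at t within I) \<longleftrightarrow> g differentiable (at t within I)" if "t \<in> I" for t
    using that Suc.prems by (rule differentiable_within_cong[rotated])
  moreover have "Ck1 I k (\<lambda>t. vector_derivative f (at t within I)) = Ck1 I k (\<lambda>t. vector_derivative g (at t within I))"
    by (rule Suc.IH, rule vector_derivative_cong_eq) (use Suc.prems in auto)
  ultimately show ?case
    by simp
qed simp

lemma smooth1_cong: "(\<And>t. t \<in> I \<Longrightarrow> f t = g t) \<Longrightarrow> smooth1 I f = smooth1 I g"
  by (simp add: smooth1_iff_Ck1 Ck1_cong[of f g])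

lemma Ck1_SucI:
  assumes "\<And>t. t \<in> I \<Longrightarrow> (f has_vector_derivative f' t) (at t within I)" and "Ck1 I k f'"
  shows "Ck1 I (Suc k) f"
proof -
  have "vector_derivative f (at t within I) = f' t" if "t \<in> I" for t
    using assms that vector_derivative_within_I by blast
  then have "Ck1 I k (\<lambda>t. vector_derivative f (at t within I))"
    using assms(2) by (subst Ck1_cong[where g = f']) auto
  then show ?thesis
    using assms(1) by (auto intro: differentiableI_vector)
qed

lemma Ck1_add: "Ck1 I k f \<Longrightarrow> Ck1 I k g \<Longrightarrow> Ck1 I k (\<lambda>t. f t + g t)"
proof (induction k arbitrary: f g)
  case (Suc k)
  then show ?case
    by (intro Ck1_SucI[where f' = "\<lambda>t. vector_derivative f (at t within I) + vector_derivative g (at t within I)"])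
       (auto intro!: derivative_intros simp: vector_derivative_works[symmetric])
qed simp

text \<open>The induction step pairs one factor with the derivative of the other. With both factors
  fully smooth, the induction hypothesis applies to such pairs without tracking levels.\<close>

lemma Ck1_mult: "smooth1 I f \<Longrightarrow> smooth1 I g \<Longrightarrow> Ck1 I k (\<lambda>t. f t * g t)"
proof (induction k arbitrary: f g)
  case (Suc k)
  show ?case
  proof (rule Ck1_SucI)
    show "((\<lambda>t. f t * g t) has_vector_derivative
       f t * vector_derivative g (at t within I) + vector_derivative f (at t within I) * g t) (at t within I)"
      if "t \<in> I" for t
      using that Suc.prems by (intro has_vector_derivative_mult smooth1_has_vector_derivative)
    show "Ck1 I k (\<lambda>t. f t * vector_derivative g (at t within I) + vector_derivative f (at t within I) * g t)"
      using Suc by (intro Ck1_add Suc.IH smooth1_deriv) auto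
  qed
qed simp

lemma smooth1_add: "smooth1 I f \<Longrightarrow> smooth1 I g \<Longrightarrow> smooth1 I (\<lambda>t. f t + g t)"
  by (simp add: smooth1_iff_Ck1 Ck1_add)

lemma smooth1_mult: "smooth1 I f \<Longrightarrow> smooth1 I g \<Longrightarrow> smooth1 I (\<lambda>t. f t * g t)"
  by (subst smooth1_iff_Ck1) (simp add: Ck1_mult)

lemma Ck1_const: "Ck1 I k (\<lambda>_. z)"
proof (induction k arbitrary: z)
  case (Suc k)
  show ?case
    by (rule Ck1_SucI[OF has_vector_derivative_const Suc.IH])
qed simp

lemma smooth1_const: "smooth1 I (\<lambda>_. z)"
  by (simp add: smooth1_iff_Ck1 Ck1_const)

lemma smooth1_slice:
  assumes "smooth2 I K" "x \<in> I"
  shows "smooth1 I (K x)"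
proof -
  have "Ck1 I k (K x)" for k
    using assms
  proof (induction k arbitrary: K)
    case (Suc k)
    then show ?case
      by (intro Ck1_SucI[where f' = "deriv01 I K x"])
         (auto intro: smooth2_has_vector_derivative01 smooth2_deriv01)
  qed simp
  then show ?thesis
    by (simp add: smooth1_iff_Ck1)
qed

lemma has_vector_derivative_smooth2_diag:
  assumes "smooth2 I K" "t \<in> I"
  shows "((\<lambda>s. K s s) has_vector_derivative deriv10 I K t t + deriv01 I K t t) (at t within I)"
  using assms convex_I
  by (intro has_vector_derivative_diag[where X = I])
     (auto intro: smooth2_has_vector_derivative01 smooth2_has_vector_derivative10
        smooth2_continuous_on smooth2_deriv01)

text \<open>The derivative along the diagonal is the sum of the diagonals of the two partial
  derivatives, which are smooth kernels again, so the induction closes.\<close>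

lemma smooth1_diag:
  assumes "smooth2 I K"
  shows "smooth1 I (\<lambda>t. K t t)"
proof -
  have "Ck1 I k (\<lambda>t. K t t)" for k
    using assms
  proof (induction k arbitrary: K)
    case (Suc k)
    have "Ck1 I k (\<lambda>t. deriv10 I K t t + deriv01 I K t t)"
      by (intro Ck1_add Suc.IH smooth2_deriv10 smooth2_deriv01 Suc.prems)
    then show ?case
      using has_vector_derivative_smooth2_diag[OF Suc.prems] by (rule Ck1_SucI[rotated])
  qed simp
  then show ?thesis
    by (simp add: smooth1_iff_Ck1)
qed

lemma Ck2_cong:
  assumes "\<And>t' t. t' \<in> I \<Longrightarrow> t \<in> I \<Longrightarrow> f t' t = g t' t"
  shows "Ck2 I k f = Ck2 I k g"
  using assms
proof (induction k arbitrary: f g)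
  case 0
  then show ?case
    by (auto intro!: continuous_on_cong)
next
  case (Suc k)
  have "continuous_on (I \<times> I) (\<lambda>(t', t). f t' t) \<longleftrightarrow> continuous_on (I \<times> I) (\<lambda>(t', t). g t' t)"
    by (rule continuous_on_cong) (use Suc.prems in auto)
  moreover have "(\<lambda>s. f s t) differentiable (at t' within I) \<longleftrightarrow> (\<lambda>s. g s t) differentiable (at t' within I)"
    and "(\<lambda>s. f t' s) differentiable (at t within I) \<longleftrightarrow> (\<lambda>s. g t' s) differentiable (at t within I)"
    if "t \<in> I" "t' \<in> I" for t t'
    using that Suc.prems by (auto intro!: differentiable_within_cong)
  moreover have "Ck2 I k (deriv10 I f) = Ck2 I k (deriv10 I g)"
    by (rule Suc.IH) (auto simp: deriv10_def Suc.prems intro!: vector_derivative_cong_eq always_eventually)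
  moreover have "Ck2 I k (deriv01 I f) = Ck2 I k (deriv01 I g)"
    by (rule Suc.IH) (auto simp: deriv01_def Suc.prems intro!: vector_derivative_cong_eq always_eventually)
  ultimately show ?case
    by simp
qed

lemma smooth2_fst:
  assumes "smooth1 I p"
  shows "smooth2 I (\<lambda>t' t. p t')"
proof -
  have *: "continuous_on (I \<times> I) (\<lambda>(t', t). p t')" if "smooth1 I p" for p
    unfolding case_prod_unfold
    by (rule continuous_on_compose2[OF smooth1_continuous_on[OF that]]) (auto intro!: continuous_intros)
  \<comment> \<open>The partial derivative in the second variable is zero, so the zero kernel is
    treated first; on I it is its own partial derivative.\<close>
  have const: "Ck2 I k (\<lambda>_ _. 0)" for k
  proof (induction k)
    case (Suc k)
    have "Ck2 I k (deriv10 I (\<lambda>_ _. 0))"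
      by (rule Ck2_cong[THEN iffD1, OF _ Suc.IH]) (simp add: deriv10_def vector_derivative_within_I[OF has_vector_derivative_const])
    moreover have "Ck2 I k (deriv01 I (\<lambda>_ _. 0))"
      by (rule Ck2_cong[THEN iffD1, OF _ Suc.IH]) (simp add: deriv01_def vector_derivative_within_I[OF has_vector_derivative_const])
    ultimately show ?case
      by simp
  qed simp
  have "Ck2 I k (\<lambda>t' t. p t')" for k
    using assms
  proof (induction k arbitrary: p)
    case (Suc k)
    have "Ck2 I k (deriv10 I (\<lambda>t' t. p t'))"
      using Suc.IH[OF smooth1_deriv[OF Suc.prems]] by (simp add: deriv10_def[abs_def])
    moreover have "Ck2 I k (deriv01 I (\<lambda>t' t. p t'))"
      by (rule Ck2_cong[THEN iffD1, OF _ const]) (simp add: deriv01_def vector_derivative_within_I[OF has_vector_derivative_const])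
    ultimately show ?case
      using Suc.prems by (simp add: * smooth1_differentiable)
  qed (simp add: *)
  then show ?thesis
    by (simp add: smooth2_def)
qed

lemma smooth2_const: "smooth2 I (\<lambda>_ _. z)"
  using smooth2_fst[OF smooth1_const] .

lemma nderiv_cong: "(\<And>t. t \<in> I \<Longrightarrow> f t = g t) \<Longrightarrow> t \<in> I \<Longrightarrow> nderiv I k f t = nderiv I k g t"
  by (induction k arbitrary: t) (auto intro!: vector_derivative_cong_eq always_eventually)

lemma nderiv_add:
  assumes "smooth1 I f" "smooth1 I g" "t \<in> I"
  shows "nderiv I k (\<lambda>t. f t + g t) t = nderiv I k f t + nderiv I k g t"
  using assms
proof (induction k arbitrary: f g)
  case (Suc k)
  have "nderiv I k (\<lambda>t. vector_derivative (\<lambda>t. f t + g t) (at t within I)) t =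
      nderiv I k (\<lambda>t. vector_derivative f (at t within I) + vector_derivative g (at t within I)) t"
    using Suc.prems
    by (intro nderiv_cong vector_derivative_within_I has_vector_derivative_add smooth1_has_vector_derivative)
  also have "\<dots> = nderiv I k (\<lambda>t. vector_derivative f (at t within I)) t
      + nderiv I k (\<lambda>t. vector_derivative g (at t within I)) t"
    using Suc.prems by (intro Suc.IH smooth1_deriv)
  finally show ?case
    by (simp only: nderiv_Suc_shift)
qed simp

section \<open>Operators on test functions\<close>

lemma test_funD:
  assumes "\<phi> \<in> test_fun I"
  shows "smooth1 I \<phi>" and "t \<notin> I \<Longrightarrow> \<phi> t = 0"
  using assms by (auto simp: test_fun_def)

text \<open>Two points are provided: c0 serves as the lower limit of integrals, and the gap between
  c0 and c gives every point up to c0 a neighbourhood on which \<phi> vanishes.\<close>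

lemma test_fun_startE:
  assumes "\<phi> \<in> test_fun I"
  obtains c c0 where "c \<in> interior I" "c0 \<in> I" "c0 < c" "\<forall>t\<le>c. \<phi> t = 0"
proof -
  obtain c where c: "c \<in> interior I" "\<forall>t\<le>c. \<phi> t = 0"
    using assms by (auto simp: test_fun_def)
  then obtain e where "e > 0" "ball c e \<subseteq> I"
    by (meson mem_interior)
  then have "c - e / 2 \<in> I"
    by (auto simp: dist_real_def subset_iff)
  with c \<open>e > 0\<close> that[of c "c - e / 2"] show ?thesis
    by simp
qed

lemma test_funI:
  assumes "smooth1 I \<phi>" "\<And>t. t \<notin> I \<Longrightarrow> \<phi> t = 0" "c \<in> interior I" "\<And>t. t \<le> c \<Longrightarrow> \<phi> t = 0"
  shows "\<phi> \<in> test_fun I"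
  using assms by (auto simp: test_fun_def)

lemma test_fun_add:
  assumes "\<phi> \<in> test_fun I" "\<psi> \<in> test_fun I"
  shows "\<phi> + \<psi> \<in> test_fun I"
proof -
  obtain c d where "c \<in> interior I" "\<forall>t\<le>c. \<phi> t = 0" "d \<in> interior I" "\<forall>t\<le>d. \<psi> t = 0"
    using assms unfolding test_fun_def by blast
  then show ?thesis
    using test_funD[OF assms(1)] test_funD[OF assms(2)]
    by (intro test_funI[where c = "min c d"]) (simp_all add: plus_fun_def min_def smooth1_add split: if_splits)
qed

lemma test_fun_mult:
  assumes "smooth1 I p" "\<phi> \<in> test_fun I"
  shows "(\<lambda>t. p t * \<phi> t) \<in> test_fun I"
  using assms unfolding test_fun_def by (auto intro: smooth1_mult)

lemma interior_I_nonempty: "\<exists>c. c \<in> interior I"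
proof -
  obtain a b where "a \<in> I" "b \<in> I" "a < b"
    using nondegenerate by blast
  then have "{a<..<b} \<subseteq> interior I"
    using atLeastAtMost_subset_I[of a b] by (intro interior_maximal) auto
  then show ?thesis
    using dense[OF \<open>a < b\<close>] by auto
qed

lemma zero_test_fun: "0 \<in> test_fun I"
  using interior_I_nonempty by (auto simp: test_fun_def smooth1_const zero_fun_def)

section \<open>Multiplication and differentiation as operators\<close>

definition mult_op :: "(real \<Rightarrow> complex) \<Rightarrow> dist" where
  "mult_op p = (\<lambda>\<phi> t. if \<phi> \<in> test_fun I then p t * \<phi> t else 0)"

definition D_op :: dist where
  "D_op = (\<lambda>\<phi> t. if \<phi> \<in> test_fun I \<and> t \<in> I then vector_derivative \<phi> (at t within I) else 0)"

text \<open>Composition distributes over a sum in the left factor by definition, in the right factor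
  by the additivity clause. The vanishing clause, together with the values being test functions,
  reduces equality of operators to a check on test functions at points of I.\<close>

definition test_op :: "dist \<Rightarrow> bool" where
  "test_op P \<longleftrightarrow> (\<forall>\<phi>. \<phi> \<notin> test_fun I \<longrightarrow> P \<phi> = 0) \<and> (\<forall>\<phi>\<in>test_fun I. P \<phi> \<in> test_fun I) \<and>
     (\<forall>\<phi>\<in>test_fun I. \<forall>\<psi>\<in>test_fun I. P (\<phi> + \<psi>) = P \<phi> + P \<psi>)"

lemma test_opD:
  assumes "test_op P"
  shows "\<phi> \<notin> test_fun I \<Longrightarrow> P \<phi> = 0"
    and "\<phi> \<in> test_fun I \<Longrightarrow> P \<phi> \<in> test_fun I"
    and "\<phi> \<in> test_fun I \<Longrightarrow> \<psi> \<in> test_fun I \<Longrightarrow> P (\<phi> + \<psi>) = P \<phi> + P \<psi>"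
  using assms by (auto simp: test_op_def)

lemma test_op_zero: "test_op P \<Longrightarrow> P 0 = 0"
  using test_opD(3)[of P 0 0] zero_test_fun by simp

lemma test_op_test_fun: "test_op P \<Longrightarrow> P \<phi> \<in> test_fun I"
  using test_opD(1,2)[of P \<phi>] zero_test_fun by (cases "\<phi> \<in> test_fun I") auto

lemma test_op_outside: "test_op P \<Longrightarrow> t \<notin> I \<Longrightarrow> P \<phi> t = 0"
  using test_op_test_fun test_funD(2) by blast

lemma test_op_eqI:
  assumes "test_op P" "test_op Q"
    and "\<And>\<phi> t. \<phi> \<in> test_fun I \<Longrightarrow> t \<in> I \<Longrightarrow> P \<phi> t = Q \<phi> t"
  shows "P = Q"
proof (intro ext)
  fix \<phi> t
  show "P \<phi> t = Q \<phi> t"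
    using assms(3)[of \<phi> t] test_opD(1)[OF assms(1), of \<phi>] test_opD(1)[OF assms(2), of \<phi>]
      test_op_outside[OF assms(1), of t \<phi>] test_op_outside[OF assms(2), of t \<phi>]
    by (cases "\<phi> \<in> test_fun I"; cases "t \<in> I") auto
qed

lemma test_op_add:
  assumes "test_op P" "test_op Q"
  shows "test_op (P + Q)"
  using assms unfolding test_op_def by (auto simp: algebra_simps intro!: test_fun_add)

lemma test_op_star:
  assumes "test_op P" "test_op Q"
  shows "test_op (P \<star> Q)"
proof -
  have "P (Q \<phi>) = 0" if "\<phi> \<notin> test_fun I" for \<phi>
    using test_opD(1)[OF assms(2) that] test_op_zero[OF assms(1)] by simp
  moreover have "P (Q \<phi>) \<in> test_fun I" if "\<phi> \<in> test_fun I" for \<phi>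
    using assms test_op_test_fun by blast
  moreover have "P (Q (\<phi> + \<psi>)) = P (Q \<phi>) + P (Q \<psi>)" if "\<phi> \<in> test_fun I" "\<psi> \<in> test_fun I" for \<phi> \<psi>
    using test_opD(3)[OF assms(2) that] test_opD(3)[OF assms(1)] test_op_test_fun[OF assms(2)] by metis
  ultimately show ?thesis
    unfolding test_op_def star_def by blast
qed

lemma star_assoc: "P \<star> Q \<star> R = P \<star> (Q \<star> R)"
  by (simp add: star_def)

lemma star_add_left: "(P + Q) \<star> R = P \<star> R + Q \<star> R"
  by (simp add: star_def plus_fun_def)

lemma star_add_right:
  assumes "test_op P" "test_op Q" "test_op R"
  shows "P \<star> (Q + R) = P \<star> Q + P \<star> R"
  using test_opD(3)[OF assms(1) test_op_test_fun[OF assms(2)] test_op_test_fun[OF assms(3)]]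
  by (simp add: star_def fun_eq_iff)

lemma test_op_mult_op: "smooth1 I p \<Longrightarrow> test_op (mult_op p)"
  unfolding test_op_def mult_op_def
  by (auto simp: fun_eq_iff distrib_left test_fun_add test_fun_mult)

lemma mult_op_star: "smooth1 I q \<Longrightarrow> mult_op p \<star> mult_op q = mult_op (p * q)"
  unfolding star_def mult_op_def
  by (auto simp: fun_eq_iff mult.assoc test_fun_mult)

lemma D_op_test_fun:
  assumes "\<phi> \<in> test_fun I"
  shows "D_op \<phi> \<in> test_fun I"
proof -
  obtain c where c: "c \<in> interior I" "\<forall>t\<le>c. \<phi> t = 0"
    using assms by (auto simp: test_fun_def)
  then obtain e where e: "e > 0" "ball c e \<subseteq> I"
    by (meson mem_interior)
  show ?thesis
  proof (rule test_funI)
    show "smooth1 I (D_op \<phi>)"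
      using smooth1_deriv[OF test_funD(1)[OF assms]]
      by (rule smooth1_cong[THEN iffD1, rotated]) (simp add: D_op_def assms)
    \<comment> \<open>Moving left of c leaves room: every point up to c - e/2 has a neighbourhood on
      which \<phi> is 0, so the derivative is 0 there.\<close>
    show "c - e / 2 \<in> interior I"
      using e by (intro interior_maximal[OF e(2) open_ball, THEN subsetD]) (simp add: dist_real_def)
    show "D_op \<phi> t = 0" if "t \<le> c - e / 2" for t
    proof (cases "t \<in> I")
      case True
      have "((\<lambda>_. 0) has_vector_derivative 0) (at t within I)"
        by simp
      then have "(\<phi> has_vector_derivative 0) (at t within I)"
        by (rule has_vector_derivative_transform_within[where d = "e / 2"])
           (use True e that c in \<open>auto simp: dist_real_def abs_if split: if_splits\<close>)
      then show ?thesis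
        using True by (simp add: D_op_def vector_derivative_within_I)
    qed (simp add: D_op_def)
  qed (simp add: D_op_def)
qed

lemma D_op_eq:
  "\<phi> \<in> test_fun I \<Longrightarrow> (\<phi> has_vector_derivative d) (at t within I) \<Longrightarrow> t \<in> I \<Longrightarrow> D_op \<phi> t = d"
  by (simp add: D_op_def vector_derivative_within_I)

lemma D_op_has_vector_derivative:
  "\<phi> \<in> test_fun I \<Longrightarrow> t \<in> I \<Longrightarrow> (\<phi> has_vector_derivative D_op \<phi> t) (at t within I)"
  by (simp add: D_op_def smooth1_has_vector_derivative test_funD(1))

lemma test_op_D_op: "test_op D_op"
proof -
  have "D_op (\<phi> + \<psi>) t = D_op \<phi> t + D_op \<psi> t"
    if "\<phi> \<in> test_fun I" "\<psi> \<in> test_fun I" for \<phi> \<psi> t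
  proof (cases "t \<in> I")
    case True
    show ?thesis
      by (rule D_op_eq[OF test_fun_add[OF that] _ True])
         (unfold plus_fun_def, intro has_vector_derivative_add D_op_has_vector_derivative that True)
  qed (simp add: D_op_def)
  then show ?thesis
    unfolding test_op_def using D_op_test_fun by (auto simp: fun_eq_iff D_op_def)
qed

section \<open>Volterra operators with smooth kernels\<close>

lemma theta_distr_outside: "\<phi> \<notin> test_fun I \<or> t \<notin> I \<Longrightarrow> theta_distr I K \<phi> t = 0"
  by (auto simp: theta_distr_def distr_def)

text \<open>Causality: the Heaviside factor kills the integrand to the right of t, and \<phi> kills
  it up to c.\<close>

lemma theta_distr_causal:
  assumes "\<forall>s\<le>c. \<phi> s = 0" "t \<le> c"
  shows "theta_distr I K \<phi> t = 0"
proof -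
  have *: "(\<lambda>\<tau>. K t \<tau> * Heaviside (t - \<tau>) * \<phi> \<tau>) = (\<lambda>_. 0)"
    using assms by (auto simp: Heaviside_def)
  show ?thesis
    unfolding theta_distr_def distr_def * by simp
qed

lemma theta_distr_eq_integral:
  assumes "\<phi> \<in> test_fun I" "t \<in> I" "c \<in> I" "c \<le> t" "\<forall>s\<le>c. \<phi> s = 0"
  shows "theta_distr I K \<phi> t = integral {c..t} (\<lambda>\<tau>. K t \<tau> * \<phi> \<tau>)"
proof -
  have "theta_distr I K \<phi> t = integral I (\<lambda>\<tau>. if \<tau> \<in> {c..t} then K t \<tau> * \<phi> \<tau> else 0)"
    using assms by (auto simp: theta_distr_def distr_def Heaviside_def intro!: integral_cong)
  also have "\<dots> = integral {c..t} (\<lambda>\<tau>. K t \<tau> * \<phi> \<tau>)"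
    using atLeastAtMost_subset_I[OF assms(3,2)] by (simp only: integral_restrict_Int Int_absorb2)
  finally show ?thesis .
qed

lemma continuous_on_kernel_mult:
  assumes "smooth2 I K" "\<phi> \<in> test_fun I" "x \<in> I" "S \<subseteq> I"
  shows "continuous_on S (\<lambda>\<tau>. K x \<tau> * \<phi> \<tau>)"
  using assms smooth2_continuous_on_slice continuous_on_subset[OF smooth1_continuous_on[OF test_funD(1)]]
  by (auto intro!: continuous_on_mult)

text \<open>Leibniz rule. The time t enters both as the first argument of K and as the upper limit
  of integration. Giving these roles separate variables x and y and differentiating along the
  diagonal produces the two terms.\<close>

lemma theta_distr_has_vector_derivative:
  assumes K: "smooth2 I K" and \<phi>: "\<phi> \<in> test_fun I" and t: "t \<in> I"
  shows "(theta_distr I K \<phi> has_vector_derivative K t t * \<phi> t + theta_distr I (deriv10 I K) \<phi> t)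
     (at t within I)"
proof -
  obtain c c0 where c: "c \<in> interior I" "c0 \<in> I" "c0 < c" "\<forall>t\<le>c. \<phi> t = 0"
    using test_fun_startE[OF \<phi>] .
  then have z: "\<forall>t\<le>c0. \<phi> t = 0"
    by simp
  show ?thesis
  proof (cases "t < c")
    case True
    have "((\<lambda>_. 0) has_vector_derivative 0) (at t within I)"
      by simp
    then have "(theta_distr I K \<phi> has_vector_derivative 0) (at t within I)"
      by (rule has_vector_derivative_transform_within[where d = "c - t"])
         (use True t c in \<open>auto simp: dist_real_def abs_if intro!: theta_distr_causal[OF c(4)] split: if_splits\<close>)
    then show ?thesis
      using theta_distr_causal[OF c(4), of t] c(4) True by simp
  next
    case False
    \<comment> \<open>The upper limit is confined to the part of I from c0 on. Near t this is all of
      I, because c0 < c \<le> t, so the derivative within Y is the one within I.\<close>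
    define Y where "Y = I \<inter> {c0..}"
    have Y: "t \<in> Y" "Y \<subseteq> I" "convex Y"
      using False t c convex_I by (auto simp: Y_def intro: convex_Int)
    have sub: "{c0..y} \<subseteq> I" if "y \<in> I" for y
      using atLeastAtMost_subset_I[OF c(2) that] .
    have "((\<lambda>y. (\<lambda>x y. integral {c0..y} (\<lambda>\<tau>. K x \<tau> * \<phi> \<tau>)) y y) has_vector_derivative
       integral {c0..t} (\<lambda>\<tau>. deriv10 I K t \<tau> * \<phi> \<tau>) + K t t * \<phi> t) (at t within Y)"
    proof (rule has_vector_derivative_diag[where X = I
          and f = "\<lambda>x y. integral {c0..y} (\<lambda>\<tau>. K x \<tau> * \<phi> \<tau>)" and dy = "\<lambda>x y. K x y * \<phi> y"])
      have "((\<lambda>x. integral (cbox c0 t) (\<lambda>\<tau>. K x \<tau> * \<phi> \<tau>)) has_vector_derivative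
          integral (cbox c0 t) (\<lambda>\<tau>. deriv10 I K t \<tau> * \<phi> \<tau>)) (at t within I)"
      proof (rule leibniz_rule_vector_derivative)
        show "((\<lambda>x. K x s * \<phi> s) has_vector_derivative deriv10 I K x s * \<phi> s) (at x within I)"
          if "x \<in> I" "s \<in> cbox c0 t" for x s
          using that sub[OF t] K
          by (intro has_vector_derivative_mult_left smooth2_has_vector_derivative10) auto
        show "(\<lambda>\<tau>. K x \<tau> * \<phi> \<tau>) integrable_on cbox c0 t" if "x \<in> I" for x
          using continuous_on_kernel_mult[OF K \<phi> that sub[OF t]]
          by (auto intro: integrable_continuous_real)
        have "continuous_on (I \<times> {c0..t}) (\<lambda>(x, y). deriv10 I K x y)"
          by (rule continuous_on_subset[OF smooth2_continuous_on[OF smooth2_deriv10[OF K]]])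
             (use sub[OF t] in auto)
        moreover have "continuous_on (I \<times> {c0..t}) (\<lambda>z. \<phi> (snd z))"
          by (rule continuous_on_compose2[OF smooth1_continuous_on[OF test_funD(1)[OF \<phi>]]])
             (use sub[OF t] in \<open>auto intro!: continuous_on_snd continuous_on_id\<close>)
        ultimately show "continuous_on (I \<times> cbox c0 t) (\<lambda>(x, y). deriv10 I K x y * \<phi> y)"
          by (simp add: case_prod_unfold continuous_on_mult)
      qed (use t convex_I in auto)
      then show "((\<lambda>s. integral {c0..t} (\<lambda>\<tau>. K s \<tau> * \<phi> \<tau>)) has_vector_derivative
          integral {c0..t} (\<lambda>\<tau>. deriv10 I K t \<tau> * \<phi> \<tau>)) (at t within I)"
        by simp
      show "((\<lambda>y. integral {c0..y} (\<lambda>\<tau>. K x \<tau> * \<phi> \<tau>)) has_vector_derivative K x y * \<phi> y) (at y within Y)"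
        if "x \<in> I" "y \<in> Y" for x y
      \<comment> \<open>The fundamental theorem is applied on a compact interval: up to a point b of
        I beyond y if there is one, and otherwise up to y, where Y then ends.\<close>
      proof (cases "\<exists>b\<in>I. y < b")
        case True
        then obtain b where b: "b \<in> I" "y < b"
          by blast
        have "((\<lambda>y. integral {c0..y} (\<lambda>\<tau>. K x \<tau> * \<phi> \<tau>)) has_vector_derivative K x y * \<phi> y) (at y within {c0..b})"
          using that b by (intro integral_has_vector_derivative continuous_on_kernel_mult K \<phi> sub) (auto simp: Y_def)
        moreover have "at y within Y = at y within {c0..b}"
          by (rule at_within_nhd[of _ "{..<b}"])
             (use b sub[OF b(1)] in \<open>auto simp: Y_def\<close>)
        ultimately show ?thesis
          by simp
      next
        case False
        then have "Y \<subseteq> {c0..y}"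
          by (auto simp: Y_def not_less)
        moreover have "((\<lambda>y. integral {c0..y} (\<lambda>\<tau>. K x \<tau> * \<phi> \<tau>)) has_vector_derivative K x y * \<phi> y) (at y within {c0..y})"
          using that by (intro integral_has_vector_derivative continuous_on_kernel_mult K \<phi> sub) (auto simp: Y_def)
        ultimately show ?thesis
          by (rule has_vector_derivative_within_subset[rotated])
      qed
      have "continuous_on (I \<times> Y) (\<lambda>(x, y). K x y)"
        by (rule continuous_on_subset[OF smooth2_continuous_on[OF K]]) (use Y in auto)
      moreover have "continuous_on (I \<times> Y) (\<lambda>z. \<phi> (snd z))"
        by (rule continuous_on_compose2[OF smooth1_continuous_on[OF test_funD(1)[OF \<phi>]]])
           (use Y in \<open>auto intro!: continuous_on_snd continuous_on_id\<close>)
      ultimately show "continuous_on (I \<times> Y) (\<lambda>(x, y). K x y * \<phi> y)"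
        by (simp add: case_prod_unfold continuous_on_mult)
    qed (use Y t in auto)
    then have "((\<lambda>y. integral {c0..y} (\<lambda>\<tau>. K y \<tau> * \<phi> \<tau>)) has_vector_derivative
       K t t * \<phi> t + theta_distr I (deriv10 I K) \<phi> t) (at t within Y)"
      using theta_distr_eq_integral[OF \<phi> t c(2) _ z] c False by (simp add: add.commute)
    then have "(theta_distr I K \<phi> has_vector_derivative
       K t t * \<phi> t + theta_distr I (deriv10 I K) \<phi> t) (at t within Y)"
      by (rule has_vector_derivative_transform[rotated 2])
         (use Y in \<open>auto simp: Y_def theta_distr_eq_integral[OF \<phi> _ c(2) _ z]\<close>)
    moreover have "at t within Y = at t within I"
      by (rule at_within_nhd[of _ "{c0<..}"]) (use c False in \<open>auto simp: Y_def\<close>)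
    ultimately show ?thesis
      by simp
  qed
qed

lemma smooth1_theta_distr:
  assumes "smooth2 I K" "\<phi> \<in> test_fun I"
  shows "smooth1 I (theta_distr I K \<phi>)"
proof -
  have "Ck1 I k (theta_distr I K \<phi>)" for k
    using assms(1)
  proof (induction k arbitrary: K)
    case (Suc k)
    have "Ck1 I k (\<lambda>t. K t t * \<phi> t + theta_distr I (deriv10 I K) \<phi> t)"
      by (intro Ck1_add Ck1_mult smooth1_diag Suc.IH smooth2_deriv10 Suc.prems test_funD(1) assms(2))
    then show ?case
      using theta_distr_has_vector_derivative[OF Suc.prems assms(2)] by (rule Ck1_SucI[rotated])
  qed simp
  then show ?thesis
    by (simp add: smooth1_iff_Ck1)
qed

lemma test_op_theta_distr:
  assumes K: "smooth2 I K"
  shows "test_op (theta_distr I K)"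
proof -
  have "theta_distr I K \<phi> \<in> test_fun I" if \<phi>: "\<phi> \<in> test_fun I" for \<phi>
  proof -
    obtain c where c: "c \<in> interior I" "\<forall>t\<le>c. \<phi> t = 0"
      using \<phi> by (auto simp: test_fun_def)
    show ?thesis
      by (rule test_funI[OF _ _ c(1)])
         (use c \<phi> K in \<open>auto intro: smooth1_theta_distr theta_distr_causal theta_distr_outside\<close>)
  qed
  moreover have "theta_distr I K (\<phi> + \<psi>) t = theta_distr I K \<phi> t + theta_distr I K \<psi> t"
    if \<phi>: "\<phi> \<in> test_fun I" and \<psi>: "\<psi> \<in> test_fun I" for \<phi> \<psi> t
  proof (cases "t \<in> I")
    case t: True
    obtain c1 where c1: "c1 \<in> interior I" "\<forall>t\<le>c1. \<phi> t = 0"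
      using \<phi> by (auto simp: test_fun_def)
    obtain c2 where c2: "c2 \<in> interior I" "\<forall>t\<le>c2. \<psi> t = 0"
      using \<psi> by (auto simp: test_fun_def)
    define c where "c = min c1 c2"
    have c: "c \<in> I" "\<forall>t\<le>c. \<phi> t = 0" "\<forall>t\<le>c. \<psi> t = 0" "\<forall>t\<le>c. (\<phi> + \<psi>) t = 0"
      using c1 c2 interior_subset by (auto simp: c_def min_def)
    show ?thesis
    proof (cases "c \<le> t")
      case True
      have sub: "{c..t} \<subseteq> I"
        using atLeastAtMost_subset_I[OF c(1) t] .
      have "theta_distr I K (\<phi> + \<psi>) t = integral {c..t} (\<lambda>\<tau>. K t \<tau> * \<phi> \<tau> + K t \<tau> * \<psi> \<tau>)"
        unfolding theta_distr_eq_integral[OF test_fun_add[OF \<phi> \<psi>] t c(1) True c(4)]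
        by (simp add: distrib_left)
      also have "\<dots> = integral {c..t} (\<lambda>\<tau>. K t \<tau> * \<phi> \<tau>) + integral {c..t} (\<lambda>\<tau>. K t \<tau> * \<psi> \<tau>)"
        by (intro Henstock_Kurzweil_Integration.integral_add integrable_continuous_real
            continuous_on_kernel_mult K \<phi> \<psi> t sub)
      finally show ?thesis
        using theta_distr_eq_integral[OF \<phi> t c(1) True c(2)] theta_distr_eq_integral[OF \<psi> t c(1) True c(3)]
        by simp
    next
      case False
      then show ?thesis
        using c theta_distr_causal[of c _ t K] by simp
    qed
  qed (simp add: theta_distr_outside)
  ultimately show ?thesis
    unfolding test_op_def by (auto simp: fun_eq_iff theta_distr_outside)
qed

lemma D_op_star_theta_distr:
  assumes "smooth2 I K"
  shows "D_op \<star> theta_distr I K = mult_op (\<lambda>t. K t t) + theta_distr I (deriv10 I K)"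
proof (rule test_op_eqI)
  fix \<phi> t assume "\<phi> \<in> test_fun I" "t \<in> I"
  then show "(D_op \<star> theta_distr I K) \<phi> t = (mult_op (\<lambda>t. K t t) + theta_distr I (deriv10 I K)) \<phi> t"
    using D_op_eq[OF test_opD(2)[OF test_op_theta_distr] theta_distr_has_vector_derivative] assms
    by (simp add: star_def mult_op_def)
qed (use smooth1_diag[OF assms] smooth2_deriv10[OF assms] assms in
      \<open>auto intro!: test_op_star test_op_add test_op_D_op test_op_theta_distr test_op_mult_op\<close>)

text \<open>Integration by parts on \<open>{c0..t}\<close>. The boundary term at c0 vanishes because
  \<phi> does.\<close>

lemma theta_distr_star_D_op:
  assumes K: "smooth2 I K"
  shows "theta_distr I K \<star> D_op + theta_distr I (deriv01 I K) = mult_op (\<lambda>t. K t t)"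
proof (rule test_op_eqI)
  fix \<phi> t assume \<phi>: "\<phi> \<in> test_fun I" and t: "t \<in> I"
  obtain c c0 where c: "c \<in> interior I" "c0 \<in> I" "c0 < c" "\<forall>t\<le>c. \<phi> t = 0"
    using test_fun_startE[OF \<phi>] .
  then have z: "\<forall>t\<le>c0. \<phi> t = 0"
    by simp
  have D: "D_op \<phi> s = 0" if "s \<le> c0" for s
  proof (cases "s \<in> I")
    case True
    have "((\<lambda>_. 0) has_vector_derivative 0) (at s within I)"
      by simp
    then have "(\<phi> has_vector_derivative 0) (at s within I)"
      by (rule has_vector_derivative_transform_within[where d = "c - c0"])
         (use True that c in \<open>auto simp: dist_real_def abs_if split: if_splits\<close>)
    then show ?thesis
      using True \<phi> D_op_eq by blast
  qed (simp add: D_op_def)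
  show "(theta_distr I K \<star> D_op + theta_distr I (deriv01 I K)) \<phi> t = mult_op (\<lambda>t. K t t) \<phi> t"
  proof (cases "c0 \<le> t")
    case True
    have sub: "{c0..t} \<subseteq> I"
      using atLeastAtMost_subset_I[OF c(2) t] .
    have "((\<lambda>\<tau>. K t \<tau> * D_op \<phi> \<tau> + deriv01 I K t \<tau> * \<phi> \<tau>) has_integral K t t * \<phi> t - K t c0 * \<phi> c0) {c0..t}"
    proof (rule fundamental_theorem_of_calculus[OF True])
      fix x assume x: "x \<in> {c0..t}"
      have "((\<lambda>\<tau>. K t \<tau> * \<phi> \<tau>) has_vector_derivative K t x * D_op \<phi> x + deriv01 I K t x * \<phi> x) (at x within I)"
        using x sub K t \<phi>
        by (intro has_vector_derivative_mult smooth2_has_vector_derivative01 D_op_has_vector_derivative) auto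
      then show "((\<lambda>\<tau>. K t \<tau> * \<phi> \<tau>) has_vector_derivative K t x * D_op \<phi> x + deriv01 I K t x * \<phi> x)
          (at x within {c0..t})"
        using sub by (rule has_vector_derivative_within_subset)
    qed
    then have "integral {c0..t} (\<lambda>\<tau>. K t \<tau> * D_op \<phi> \<tau> + deriv01 I K t \<tau> * \<phi> \<tau>) = K t t * \<phi> t"
      using z by (simp add: integral_unique)
    moreover have "integral {c0..t} (\<lambda>\<tau>. K t \<tau> * D_op \<phi> \<tau> + deriv01 I K t \<tau> * \<phi> \<tau>) =
        integral {c0..t} (\<lambda>\<tau>. K t \<tau> * D_op \<phi> \<tau>) + integral {c0..t} (\<lambda>\<tau>. deriv01 I K t \<tau> * \<phi> \<tau>)"
      by (intro Henstock_Kurzweil_Integration.integral_add integrable_continuous_real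
            continuous_on_kernel_mult K smooth2_deriv01 \<phi> D_op_test_fun t sub)
    ultimately show ?thesis
      using theta_distr_eq_integral[OF \<phi> t c(2) True z] D
        theta_distr_eq_integral[OF D_op_test_fun[OF \<phi>] t c(2) True]
      by (simp add: star_def mult_op_def \<phi>)
  next
    case False
    then show ?thesis
      using theta_distr_causal[OF z, of t] theta_distr_causal[of c0 "D_op \<phi>" t] D z \<phi>
      by (simp add: star_def mult_op_def)
  qed
qed (use smooth1_diag[OF assms] smooth2_deriv01[OF assms] assms in
      \<open>auto intro!: test_op_star test_op_add test_op_D_op test_op_theta_distr test_op_mult_op\<close>)

end

section \<open>Flat functions\<close>

text \<open>The functions x^(-m) exp(-1/x), continued by 0 to x \<le> 0. The parameter m closes the
  family under differentiation: the derivative is a combination of the next two members.\<close>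

definition flat :: "nat \<Rightarrow> real \<Rightarrow> real" where
  "flat m x = (if x > 0 then inverse x ^ m / exp (inverse x) else 0)"

text \<open>This is the difference quotient at 0. From the right, y = 1/h turns it into y^(m+1) /
  exp y as y tends to infinity; from the left it is 0.\<close>

lemma flat_div_tendsto_0: "((\<lambda>h. flat m h / h) \<longlongrightarrow> 0) (at 0)"
proof -
  have "((\<lambda>h. flat m h / h) \<longlongrightarrow> 0) (at_right 0)"
  proof -
    have "((\<lambda>h::real. inverse h ^ Suc m / exp (inverse h)) \<longlongrightarrow> 0) (at_right 0)"
      using tendsto_power_div_exp_0 filterlim_inverse_at_top_right by (rule filterlim_compose)
    moreover have "eventually (\<lambda>h. inverse h ^ Suc m / exp (inverse h) = flat m h / h) (at_right 0)"
      using eventually_at_right_less[of 0] by eventually_elim (simp add: flat_def field_simps)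
    ultimately show ?thesis
      by (rule Lim_transform_eventually)
  qed
  moreover have "((\<lambda>h. flat m h / h) \<longlongrightarrow> 0) (at_left 0)"
    by (rule tendsto_eventually) (simp add: flat_def eventually_at_filter)
  ultimately show ?thesis
    by (simp add: filterlim_split_at)
qed

lemma flat_has_real_derivative:
  "(flat m has_real_derivative flat (m + 2) x - m * flat (m + 1) x) (at x)"
proof (cases x "0 :: real" rule: linorder_cases)
  case less
  have "((\<lambda>_. 0) has_real_derivative 0) (at x)"
    by simp
  then have "(flat m has_real_derivative 0) (at x)"
    by (rule has_field_derivative_transform_within_open[where S = "{..<0}"])
       (use less in \<open>auto simp: flat_def\<close>)
  then show ?thesis
    using less by (simp add: flat_def)
next
  case equal
  then show ?thesis
    using flat_div_tendsto_0[of m] by (simp add: DERIV_def flat_def)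
next
  case greater
  have "((\<lambda>x. inverse x ^ m / exp (inverse x)) has_real_derivative
      (real m * inverse x ^ (m - 1) * - (inverse x ^ 2) * exp (inverse x) - inverse x ^ m * (exp (inverse x) * - (inverse x ^ 2)))
        / (exp (inverse x) * exp (inverse x))) (at x)"
    using greater by (auto intro!: derivative_eq_intros simp: power2_eq_square)
  also have "(real m * inverse x ^ (m - 1) * - (inverse x ^ 2) * exp (inverse x) - inverse x ^ m * (exp (inverse x) * - (inverse x ^ 2)))
        / (exp (inverse x) * exp (inverse x)) = flat (m + 2) x - m * flat (m + 1) x"
    using greater by (cases m) (simp_all add: flat_def field_simps power2_eq_square)
  finally show ?thesis
    by (rule has_field_derivative_transform_within_open[where S = "{0<..}"])
       (use greater in \<open>auto simp: flat_def\<close>)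
qed

lemma flat_mono:
  assumes "x \<le> y"
  shows "flat 0 x \<le> flat 0 y"
  using assms by (auto simp: flat_def divide_simps)

context time_interval
begin

text \<open>For factors known only at level k, as in the induction for \<open>flat\<close>, where
  \<open>Ck1_mult\<close> does not apply.\<close>

lemma Ck1_cmult: "Ck1 I k f \<Longrightarrow> Ck1 I k (\<lambda>t. z * f t)"
proof (induction k arbitrary: f)
  case (Suc k)
  have "((\<lambda>t. z * f t) has_vector_derivative z * vector_derivative f (at t within I)) (at t within I)"
    if "t \<in> I" for t
    using Suc.prems that by (intro has_vector_derivative_mult_right) (simp add: vector_derivative_works[symmetric])
  then show ?case
    by (rule Ck1_SucI) (assumption, rule Suc.IH, use Suc.prems in simp)
qed simp

lemma smooth1_flat: "smooth1 I (\<lambda>t. of_real (flat m (t - c)))"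
proof -
  have "Ck1 I k (\<lambda>t. of_real (flat m (t - c)))" for k
  proof (induction k arbitrary: m)
    case (Suc k)
    show ?case
    proof (rule Ck1_SucI)
      fix t
      have "((\<lambda>t. flat m (t - c)) has_real_derivative (flat (m + 2) (t - c) - m * flat (m + 1) (t - c)) * (1 - 0)) (at t within I)"
        by (rule DERIV_chain'[OF DERIV_diff[OF DERIV_ident DERIV_const] flat_has_real_derivative])
      then have "((\<lambda>t. flat m (t - c)) has_real_derivative flat (m + 2) (t - c) - m * flat (m + 1) (t - c)) (at t within I)"
        by (simp only: diff_zero mult_1_right)
      from has_vector_derivative_of_real[OF this]
      show "((\<lambda>t. of_real (flat m (t - c))) has_vector_derivative
          complex_of_real (flat (m + 2) (t - c)) + (- of_nat m) * complex_of_real (flat (m + 1) (t - c))) (at t within I)"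
        by simp
      show "Ck1 I k (\<lambda>t. complex_of_real (flat (m + 2) (t - c)) + (- of_nat m) * complex_of_real (flat (m + 1) (t - c)))"
        by (intro Ck1_add Ck1_cmult Suc.IH)
    qed
  qed simp
  then show ?thesis
    by (simp add: smooth1_iff_Ck1)
qed

text \<open>The flat function started at c is divided by its value at t. Monotonicity then bounds it
  by 1 on \<open>{c..t}\<close>, however close c is to t.\<close>

lemma peak_test_fun:
  assumes c: "c \<in> interior I" and t: "t \<in> I" "c < t"
  obtains \<psi> where "\<psi> \<in> test_fun I" "\<forall>s\<le>c. \<psi> s = 0" "\<forall>s\<in>{c..t}. norm (\<psi> s) \<le> 1" "\<psi> t = 1"
proof
  define \<psi> where "\<psi> = (\<lambda>s. if s \<in> I then of_real (1 / flat 0 (t - c)) * complex_of_real (flat 0 (s - c)) else 0)"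
  have pos: "flat 0 (t - c) > 0"
    using t by (simp add: flat_def)
  have "smooth1 I (\<lambda>s. of_real (1 / flat 0 (t - c)) * complex_of_real (flat 0 (s - c)))"
    by (intro smooth1_mult smooth1_const smooth1_flat)
  then have "smooth1 I \<psi>"
    by (rule smooth1_cong[THEN iffD1, rotated]) (simp add: \<psi>_def)
  then show "\<psi> \<in> test_fun I"
    by (rule test_funI[OF _ _ c]) (auto simp: \<psi>_def flat_def)
  show "\<forall>s\<le>c. \<psi> s = 0"
    by (simp add: \<psi>_def flat_def)
  show "\<psi> t = 1"
    using t pos by (simp add: \<psi>_def)
  show "\<forall>s\<in>{c..t}. norm (\<psi> s) \<le> 1"
  proof
    fix s assume s: "s \<in> {c..t}"
    have "0 \<le> flat 0 (s - c)" "flat 0 (s - c) \<le> flat 0 (t - c)"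
      using s by (simp add: flat_def, intro flat_mono) simp
    then show "norm (\<psi> s) \<le> 1"
      using pos by (auto simp: \<psi>_def norm_mult norm_divide divide_simps)
  qed
qed

section \<open>Integration as the inverse of differentiation\<close>

abbreviation J_op :: dist where
  "J_op \<equiv> theta_distr I (\<lambda>_ _. 1)"

lemma delta_const_eq_mult_op: "delta_const I z = mult_op (\<lambda>_. z)"
  by (auto simp: delta_const_def distr_def mult_op_def fun_eq_iff test_funD(2))

lemma test_op_one: "test_op (star_one I)"
  by (simp add: delta_const_eq_mult_op test_op_mult_op smooth1_const)

lemma star_one_left: "test_op P \<Longrightarrow> star_one I \<star> P = P"
  by (simp add: delta_const_eq_mult_op star_def mult_op_def fun_eq_iff test_op_test_fun)

lemma star_one_right: "test_op P \<Longrightarrow> P \<star> star_one I = P"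
  by (rule test_op_eqI[OF test_op_star[OF _ test_op_one]])
     (simp_all add: delta_const_eq_mult_op star_def mult_op_def)

lemma mult_op_minus_one_star: "test_op P \<Longrightarrow> mult_op (\<lambda>_. -1) \<star> P = - P"
  by (simp add: star_def mult_op_def fun_eq_iff test_op_test_fun)

lemma test_op_J_op: "test_op J_op"
  by (simp add: smooth2_const test_op_theta_distr)

lemma theta_distr_zero:
  assumes "\<And>t s. t \<in> I \<Longrightarrow> s \<in> I \<Longrightarrow> K t s = 0"
  shows "theta_distr I K = 0"
proof (intro ext)
  fix \<phi> t
  have "t \<in> I \<Longrightarrow> integral I (\<lambda>\<tau>. K t \<tau> * Heaviside (t - \<tau>) * \<phi> \<tau>) = 0"
    using assms by (simp add: integral_cong[of I _ "\<lambda>_. 0"])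
  then show "theta_distr I K \<phi> t = (0 :: dist) \<phi> t"
    by (simp add: theta_distr_def distr_def)
qed

lemma D_op_star_J_op: "D_op \<star> J_op = star_one I"
proof -
  have "theta_distr I (deriv10 I (\<lambda>_ _. 1)) = 0"
    by (rule theta_distr_zero) (simp add: deriv10_def vector_derivative_within_I[OF has_vector_derivative_const])
  then show ?thesis
    using D_op_star_theta_distr[OF smooth2_const, of 1] by (simp add: delta_const_eq_mult_op)
qed

lemma J_op_star_D_op: "J_op \<star> D_op = star_one I"
proof -
  have "theta_distr I (deriv01 I (\<lambda>_ _. 1)) = 0"
    by (rule theta_distr_zero) (simp add: deriv01_def vector_derivative_within_I[OF has_vector_derivative_const])
  then show ?thesis
    using theta_distr_star_D_op[OF smooth2_const, of 1] by (simp add: delta_const_eq_mult_op)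
qed

text \<open>The minus sign is written as multiplication by -1, so that the right-hand side is
  assembled from generators of \<open>order0\<close>.\<close>

lemma theta_distr_star_D_op':
  assumes "smooth2 I K"
  shows "theta_distr I K \<star> D_op =
    mult_op (\<lambda>t. K t t) + mult_op (\<lambda>_. -1) \<star> theta_distr I (deriv01 I K)"
  using theta_distr_star_D_op[OF assms]
  by (simp add: mult_op_minus_one_star test_op_theta_distr smooth2_deriv01 assms flip: eq_diff_eq)

lemma D_op_star_mult_op:
  assumes p: "smooth1 I p"
  shows "D_op \<star> mult_op p = mult_op p \<star> D_op + mult_op (\<lambda>t. vector_derivative p (at t within I))"
proof (rule test_op_eqI)
  fix \<phi> t assume \<phi>: "\<phi> \<in> test_fun I" and t: "t \<in> I"
  have eq: "mult_op p \<phi> = (\<lambda>t. p t * \<phi> t)"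
    by (simp add: mult_op_def \<phi>)
  have "(mult_op p \<phi> has_vector_derivative p t * D_op \<phi> t + vector_derivative p (at t within I) * \<phi> t) (at t within I)"
    unfolding eq
    using t p \<phi> by (intro has_vector_derivative_mult smooth1_has_vector_derivative D_op_has_vector_derivative)
  then have "D_op (mult_op p \<phi>) t = p t * D_op \<phi> t + vector_derivative p (at t within I) * \<phi> t"
    using D_op_eq \<phi> t p test_opD(2)[OF test_op_mult_op] by blast
  then show "(D_op \<star> mult_op p) \<phi> t =
      (mult_op p \<star> D_op + mult_op (\<lambda>t. vector_derivative p (at t within I))) \<phi> t"
    using \<phi> by (simp add: star_def mult_op_def D_op_test_fun)
qed (use p smooth1_deriv[OF p] in \<open>auto intro!: test_op_star test_op_add test_op_D_op test_op_mult_op\<close>)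

section \<open>Operators of order zero\<close>

text \<open>
  Keeping compositions of Volterra operators as generators avoids computing their kernels;
  the bound \<open>order0_estimate\<close> is all that is needed of them. The second argument is part of the
  derivation here; that the operator determines it is \<open>order0_unique_at\<close>.
\<close>

inductive order0 :: "dist \<Rightarrow> (real \<Rightarrow> complex) \<Rightarrow> bool" where
  order0_mult: "smooth1 I p \<Longrightarrow> order0 (mult_op p) p"
| order0_theta: "smooth2 I K \<Longrightarrow> order0 (theta_distr I K) 0"
| order0_add: "order0 P p \<Longrightarrow> order0 Q q \<Longrightarrow> order0 (P + Q) (p + q)"
| order0_star: "order0 P p \<Longrightarrow> order0 Q q \<Longrightarrow> order0 (P \<star> Q) (p * q)"

lemma order0_test_op: "order0 P p \<Longrightarrow> test_op P"
  by (induction rule: order0.induct) (blast intro: test_op_mult_op test_op_theta_distr test_op_add test_op_star)+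

lemma order0_smooth1: "order0 P p \<Longrightarrow> smooth1 I p"
proof (induction rule: order0.induct)
  case (order0_theta K)
  then show ?case using smooth1_const[of 0] by (simp add: zero_fun_def)
next
  case (order0_add P p Q q)
  then show ?case using smooth1_add by (simp add: plus_fun_def)
next
  case (order0_star P p Q q)
  then show ?case using smooth1_mult by (simp add: times_fun_def)
qed

lemma order0_J_op: "order0 J_op 0"
  by (simp add: order0_theta smooth2_const)

lemma order0_minus: "order0 P p \<Longrightarrow> order0 (- P) (- p)"
  using order0_star[OF order0_mult[OF smooth1_const[of "-1"]], of P p] mult_op_minus_one_star[OF order0_test_op, of P p]
  by (simp add: times_fun_def fun_Compl_def)

text \<open>P' is D P J. For a multiplication, D p J = p + p' J. For a Volterra operator, D K is of
  order zero by the Leibniz rule, and the trailing J makes the symbol 0. Sums and products inherit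
  the claim.\<close>

lemma order0_conj_D: "order0 P p \<Longrightarrow> \<exists>P'. order0 P' p \<and> D_op \<star> P = P' \<star> D_op"
proof (induction rule: order0.induct)
  case (order0_mult p)
  let ?p' = "\<lambda>t. vector_derivative p (at t within I)"
  have "order0 (mult_op p + mult_op ?p' \<star> J_op) (p + ?p' * 0)"
    by (intro order0.intros order0_J_op order0_mult smooth1_deriv)
  moreover have "D_op \<star> mult_op p = (mult_op p + mult_op ?p' \<star> J_op) \<star> D_op"
    using order0_mult by (simp add: D_op_star_mult_op star_add_left star_assoc J_op_star_D_op star_one_right test_op_mult_op smooth1_deriv)
  ultimately show ?case
    by auto
next
  case (order0_theta K)
  let ?P = "mult_op (\<lambda>t. K t t) + theta_distr I (deriv10 I K)"
  have "order0 (?P \<star> J_op) (((\<lambda>t. K t t) + 0) * 0)"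
    by (intro order0.intros order0_J_op order0_theta smooth1_diag smooth2_deriv10)
  then have "order0 (?P \<star> J_op) 0"
    by (simp only: mult_zero_right)
  moreover have "D_op \<star> theta_distr I K = (?P \<star> J_op) \<star> D_op"
    using order0_theta
    by (simp add: D_op_star_theta_distr star_assoc J_op_star_D_op star_one_right test_op_add test_op_mult_op
        smooth1_diag test_op_theta_distr smooth2_deriv10)
  ultimately show ?case
    by blast
next
  case (order0_add P p Q q)
  then obtain P' Q' where "order0 P' p" "D_op \<star> P = P' \<star> D_op" "order0 Q' q" "D_op \<star> Q = Q' \<star> D_op"
    by blast
  then have "order0 (P' + Q') (p + q)" "D_op \<star> (P + Q) = (P' + Q') \<star> D_op"
    using order0_add.hyps by (simp_all add: order0.order0_add star_add_left star_add_right order0_test_op test_op_D_op)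
  then show ?case
    by blast
next
  case (order0_star P p Q q)
  then obtain P' Q' where P': "order0 P' p" "D_op \<star> P = P' \<star> D_op" and Q': "order0 Q' q" "D_op \<star> Q = Q' \<star> D_op"
    by blast
  have "D_op \<star> (P \<star> Q) = (P' \<star> Q') \<star> D_op"
    using P'(2) Q'(2) by (metis star_assoc)
  then show ?case
    using order0.order0_star[OF P'(1) Q'(1)] by blast
qed

text \<open>P' is J P D. For a multiplication the product rule gives J p D = p - J p'. For a
  Volterra operator, K D is of order zero by integration by parts, and the leading J makes the
  symbol 0.\<close>

lemma order0_conj_J: "order0 P p \<Longrightarrow> \<exists>P'. order0 P' p \<and> J_op \<star> P = P' \<star> J_op"
proof (induction rule: order0.induct)
  case (order0_mult p)
  let ?p' = "\<lambda>t. vector_derivative p (at t within I)"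
  let ?P = "mult_op p + - (J_op \<star> mult_op ?p')"
  have tp: "test_op (mult_op p)" "test_op (mult_op ?p')"
    using order0_mult by (simp_all add: test_op_mult_op smooth1_deriv)
  have "order0 ?P (p + - (0 * ?p'))"
    by (intro order0.intros order0_J_op order0_mult smooth1_deriv order0_minus)
  moreover have "J_op \<star> mult_op p = ?P \<star> J_op"
  proof -
    have "J_op \<star> (D_op \<star> mult_op p) = J_op \<star> (mult_op p \<star> D_op) + J_op \<star> mult_op ?p'"
      unfolding D_op_star_mult_op[OF order0_mult]
      by (intro star_add_right test_op_J_op test_op_star tp test_op_D_op)
    then have "mult_op p = J_op \<star> (mult_op p \<star> D_op) + J_op \<star> mult_op ?p'"
      by (simp add: J_op_star_D_op star_one_left tp flip: star_assoc)
    then have "?P = J_op \<star> (mult_op p \<star> D_op)"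
      by (simp add: algebra_simps)
    then show ?thesis
      by (simp add: star_assoc D_op_star_J_op star_one_right tp)
  qed
  ultimately show ?case
    by auto
next
  case (order0_theta K)
  let ?P = "mult_op (\<lambda>t. K t t) + mult_op (\<lambda>_. -1) \<star> theta_distr I (deriv01 I K)"
  have "order0 (J_op \<star> ?P) (0 * ((\<lambda>t. K t t) + (\<lambda>_. -1) * 0))"
    by (intro order0.intros order0_J_op order0_theta smooth1_diag smooth2_deriv01 smooth1_const)
  then have "order0 (J_op \<star> ?P) 0"
    by (simp only: mult_zero_left)
  moreover have "J_op \<star> theta_distr I K = (J_op \<star> ?P) \<star> J_op"
    using order0_theta
    by (simp add: theta_distr_star_D_op'[symmetric] star_assoc D_op_star_J_op star_one_right test_op_theta_distr)
  ultimately show ?case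
    by blast
next
  case (order0_add P p Q q)
  then obtain P' Q' where "order0 P' p" "J_op \<star> P = P' \<star> J_op" "order0 Q' q" "J_op \<star> Q = Q' \<star> J_op"
    by blast
  then have "order0 (P' + Q') (p + q)" "J_op \<star> (P + Q) = (P' + Q') \<star> J_op"
    using order0_add.hyps by (simp_all add: order0.order0_add star_add_left star_add_right order0_test_op test_op_J_op)
  then show ?case
    by blast
next
  case (order0_star P p Q q)
  then obtain P' Q' where P': "order0 P' p" "J_op \<star> P = P' \<star> J_op" and Q': "order0 Q' q" "J_op \<star> Q = Q' \<star> J_op"
    by blast
  have "J_op \<star> (P \<star> Q) = (P' \<star> Q') \<star> J_op"
    using P'(2) Q'(2) by (metis star_assoc)
  then show ?case
    using order0.order0_star[OF P'(1) Q'(1)] by blast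
qed

text \<open>Splits off the leading term: what P D contains besides p D is of order zero again. In a
  product, q D is rewritten as D q - q', which brings D next to P, where its induction hypothesis
  applies.\<close>

lemma order0_star_D_op: "order0 P p \<Longrightarrow> \<exists>S s. order0 S s \<and> P \<star> D_op = mult_op p \<star> D_op + S"
proof (induction rule: order0.induct)
  case (order0_mult p)
  have "order0 (mult_op 0) 0"
    using order0.order0_mult[OF smooth1_const[of 0]] by (simp add: zero_fun_def)
  moreover have "mult_op 0 = 0"
    by (simp add: mult_op_def fun_eq_iff)
  ultimately show ?case
    by (metis add.right_neutral)
next
  case (order0_theta K)
  have "mult_op 0 \<star> D_op = 0"
    by (simp add: mult_op_def fun_eq_iff star_def)
  moreover have "order0 (theta_distr I K \<star> D_op) ((\<lambda>t. K t t) + (\<lambda>_. -1) * 0)"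
    unfolding theta_distr_star_D_op'[OF order0_theta]
    by (intro order0.intros order0_theta smooth1_diag smooth2_deriv01 smooth1_const)
  ultimately show ?case
    by (metis add.left_neutral)
next
  case (order0_add P p Q q)
  then obtain S s R r where S: "order0 S s" "P \<star> D_op = mult_op p \<star> D_op + S"
    and R: "order0 R r" "Q \<star> D_op = mult_op q \<star> D_op + R"
    by blast
  have "mult_op (p + q) = mult_op p + mult_op q"
    by (auto simp: mult_op_def fun_eq_iff algebra_simps)
  then have "(P + Q) \<star> D_op = mult_op (p + q) \<star> D_op + (S + R)"
    using S R by (simp add: star_add_left algebra_simps)
  then show ?case
    using order0.order0_add[OF S(1) R(1)] by blast
next
  case (order0_star P p Q q)
  then obtain S s R r where S: "order0 S s" "P \<star> D_op = mult_op p \<star> D_op + S"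
    and R: "order0 R r" "Q \<star> D_op = mult_op q \<star> D_op + R"
    by blast
  have p: "smooth1 I p" and q: "smooth1 I q"
    using order0_star.hyps order0_smooth1 by auto
  let ?q' = "\<lambda>t. vector_derivative q (at t within I)"
  note t = test_op_mult_op[OF p] test_op_mult_op[OF q] test_op_mult_op[OF smooth1_deriv[OF q]]
    order0_test_op[OF order0_star.hyps(1)] order0_test_op[OF order0_star.hyps(2)] order0_test_op[OF S(1)] order0_test_op[OF R(1)]
    test_op_D_op order0_test_op[OF order0_minus[OF order0.order0_mult[OF smooth1_deriv[OF q]]]]
  have "mult_op q \<star> D_op = D_op \<star> mult_op q + - mult_op ?q'"
    using D_op_star_mult_op[OF q] by simp
  then have "P \<star> (mult_op q \<star> D_op) = P \<star> (D_op \<star> mult_op q) + P \<star> - mult_op ?q'"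
    by (simp only:) (intro star_add_right test_op_star t)
  also have "P \<star> (D_op \<star> mult_op q) = mult_op p \<star> (D_op \<star> mult_op q) + S \<star> mult_op q"
    using S(2) by (metis star_assoc star_add_left)
  also have "mult_op p \<star> (D_op \<star> mult_op q) = mult_op p \<star> (mult_op q \<star> D_op) + mult_op p \<star> mult_op ?q'"
    unfolding D_op_star_mult_op[OF q] by (intro star_add_right test_op_star t)
  also have "mult_op p \<star> (mult_op q \<star> D_op) = mult_op (p * q) \<star> D_op"
    using mult_op_star[OF q] by (simp flip: star_assoc)
  finally have *: "P \<star> (mult_op q \<star> D_op) = mult_op (p * q) \<star> D_op + mult_op p \<star> mult_op ?q'
      + S \<star> mult_op q + P \<star> - mult_op ?q'" .
  have **: "P \<star> (mult_op q \<star> D_op + R) = P \<star> (mult_op q \<star> D_op) + P \<star> R"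
    by (intro star_add_right test_op_star t)
  have "P \<star> Q \<star> D_op = mult_op (p * q) \<star> D_op +
      (mult_op p \<star> mult_op ?q' + S \<star> mult_op q + P \<star> - mult_op ?q' + P \<star> R)"
    unfolding star_assoc R(2) ** * by (simp only: add.assoc)
  moreover have "order0 (mult_op p \<star> mult_op ?q' + S \<star> mult_op q + P \<star> - mult_op ?q' + P \<star> R)
      (p * ?q' + s * q + p * - ?q' + p * r)"
    by (intro order0.intros order0_minus smooth1_deriv p q S R order0_star.hyps)
  ultimately show ?case
    by blast
qed

section \<open>Action of order-zero operators on narrow peaks\<close>

lemma order0_causal:
  assumes "order0 P p" "\<forall>s\<le>c. \<phi> s = 0" "t \<le> c"
  shows "P \<phi> t = 0"
  using assms
proof (induction arbitrary: \<phi> t rule: order0.induct)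
  case (order0_theta K)
  then show ?case using theta_distr_causal by blast
qed (auto simp: mult_op_def star_def)

text \<open>On functions vanishing up to c, P is multiplication by p up to a relative error of size
  t - c. B does not depend on c, so that c may tend to t.\<close>

abbreviation mult_close :: "real \<Rightarrow> real \<Rightarrow> dist \<Rightarrow> (real \<Rightarrow> complex) \<Rightarrow> real \<Rightarrow> bool" where
  "mult_close a t P p B \<equiv> \<forall>\<phi>\<in>test_fun I. \<forall>c\<in>{a..t}. \<forall>M.
     (\<forall>s\<le>c. \<phi> s = 0) \<longrightarrow> (\<forall>s\<in>{c..t}. norm (\<phi> s) \<le> M) \<longrightarrow>
     (\<forall>s\<in>{c..t}. norm (P \<phi> s - p s * \<phi> s) \<le> B * (t - c) * M)"

text \<open>A Volterra operator gains the length of the integration interval. For products, P Q - p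
  q = (P - p) Q + p (Q - q). By causality Q \<phi> also vanishes up to c, so the estimate for P
  applies to it.\<close>

lemma order0_estimate:
  assumes "order0 P p" and a: "a \<in> I" and t: "t \<in> I"
  shows "\<exists>B\<ge>0. mult_close a t P p B"
  using assms(1)
proof (induction rule: order0.induct)
  case (order0_mult p)
  then show ?case
    by (intro exI[of _ 0]) (simp add: mult_op_def)
next
  case (order0_theta K)
  have sub: "{a..t} \<subseteq> I"
    using atLeastAtMost_subset_I[OF a t] .
  have "compact ((\<lambda>(x, y). K x y) ` ({a..t} \<times> {a..t}))"
    by (intro compact_continuous_image compact_Times compact_Icc
        continuous_on_subset[OF smooth2_continuous_on[OF order0_theta]]) (use sub in auto)
  then obtain B where B: "\<And>x y. x \<in> {a..t} \<Longrightarrow> y \<in> {a..t} \<Longrightarrow> norm (K x y) \<le> B"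
    by (force dest!: compact_imp_bounded simp: bounded_iff)
  have "norm (theta_distr I K \<phi> s - 0 s * \<phi> s) \<le> \<bar>B\<bar> * (t - c) * M"
    if \<phi>: "\<phi> \<in> test_fun I" and c: "c \<in> {a..t}" and z: "\<forall>s\<le>c. \<phi> s = 0"
      and M: "\<forall>s\<in>{c..t}. norm (\<phi> s) \<le> M" and s: "s \<in> {c..t}" for \<phi> c M s
  proof -
    have cI: "c \<in> I" and sI: "s \<in> I" and cs: "c \<le> s"
      using c s sub by auto
    have M0: "0 \<le> M"
      using M s norm_ge_zero order_trans by blast
    have "norm (integral {c..s} (\<lambda>\<tau>. K s \<tau> * \<phi> \<tau>)) \<le> (\<bar>B\<bar> * M) * (s - c)"
    proof (rule integral_bound[OF cs])
      show "continuous_on {c..s} (\<lambda>\<tau>. K s \<tau> * \<phi> \<tau>)"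
        by (intro continuous_on_kernel_mult order0_theta \<phi> sI atLeastAtMost_subset_I cI)
      fix \<tau> assume "\<tau> \<in> {c..s}"
      then have "norm (K s \<tau>) \<le> \<bar>B\<bar>" "norm (\<phi> \<tau>) \<le> M"
        using B[of s \<tau>] M s c by auto
      then show "norm (K s \<tau> * \<phi> \<tau>) \<le> \<bar>B\<bar> * M"
        by (simp add: norm_mult mult_mono')
    qed
    also have "\<dots> \<le> (\<bar>B\<bar> * M) * (t - c)"
      using s M0 by (intro mult_left_mono) auto
    finally show ?thesis
      by (simp add: theta_distr_eq_integral[OF \<phi> sI cI cs z] mult_ac)
  qed
  then show ?case
    by (intro exI[of _ "\<bar>B\<bar>"]) auto
next
  case (order0_add P p Q q)
  obtain B C where B: "B \<ge> 0" "mult_close a t P p B"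
    and C: "C \<ge> 0" "mult_close a t Q q C"
    using order0_add.IH by blast
  have "norm ((P + Q) \<phi> s - (p + q) s * \<phi> s) \<le> (B + C) * (t - c) * M"
    if h: "\<phi> \<in> test_fun I" "c \<in> {a..t}" "\<forall>s\<le>c. \<phi> s = 0" "\<forall>s\<in>{c..t}. norm (\<phi> s) \<le> M" "s \<in> {c..t}" for \<phi> c M s
  proof -
    have "(P + Q) \<phi> s - (p + q) s * \<phi> s = (P \<phi> s - p s * \<phi> s) + (Q \<phi> s - q s * \<phi> s)"
      by (simp add: algebra_simps)
    also have "norm \<dots> \<le> B * (t - c) * M + C * (t - c) * M"
      using B(2) C(2) h by (intro norm_triangle_mono) blast+
    finally show ?thesis
      by (simp add: algebra_simps)
  qed
  then show ?case
    using B(1) C(1) by (intro exI[of _ "B + C"]) auto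
next
  case (order0_star P p Q q)
  obtain B C where B: "B \<ge> 0" "mult_close a t P p B"
    and C: "C \<ge> 0" "mult_close a t Q q C"
    using order0_star.IH by blast
  have bdd: "\<exists>K\<ge>0. \<forall>s\<in>{a..t}. norm (r s) \<le> K" if "smooth1 I r" for r
  proof -
    have "compact (r ` {a..t})"
      using atLeastAtMost_subset_I[OF a t] smooth1_continuous_on[OF that]
      by (intro compact_continuous_image compact_Icc) (rule continuous_on_subset)
    then obtain K where "\<forall>x\<in>r ` {a..t}. norm x \<le> K"
      by (auto dest!: compact_imp_bounded simp: bounded_iff)
    then show ?thesis
      by (intro exI[of _ "\<bar>K\<bar>"]) (auto intro: order_trans[OF _ abs_ge_self])
  qed
  obtain Kp Kq where Kp: "Kp \<ge> 0" "\<And>s. s \<in> {a..t} \<Longrightarrow> norm (p s) \<le> Kp"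
    and Kq: "Kq \<ge> 0" "\<And>s. s \<in> {a..t} \<Longrightarrow> norm (q s) \<le> Kq"
    using bdd order0_smooth1 order0_star.hyps by metis
  have "norm ((P \<star> Q) \<phi> s - (p * q) s * \<phi> s) \<le> (B * (Kq + C * (t - a)) + Kp * C) * (t - c) * M"
    if h: "\<phi> \<in> test_fun I" "c \<in> {a..t}" "\<forall>s\<le>c. \<phi> s = 0" "\<forall>s\<in>{c..t}. norm (\<phi> s) \<le> M" "s \<in> {c..t}" for \<phi> c M s
  proof -
    have M0: "0 \<le> M"
      using h(4,5) norm_ge_zero order_trans by blast
    have Q: "norm (Q \<phi> x - q x * \<phi> x) \<le> C * (t - c) * M" if "x \<in> {c..t}" for x
      using C(2) h that by blast
    have "norm (Q \<phi> x) \<le> (Kq + C * (t - a)) * M" if x: "x \<in> {c..t}" for x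
    proof -
      have "norm (Q \<phi> x) \<le> norm (Q \<phi> x - q x * \<phi> x) + norm (q x * \<phi> x)"
        by (metis diff_add_cancel norm_triangle_ineq)
      also have "norm (q x * \<phi> x) \<le> Kq * M"
        using Kq h x by (auto simp: norm_mult intro!: mult_mono')
      also have "norm (Q \<phi> x - q x * \<phi> x) \<le> C * (t - c) * M"
        using Q[OF x] .
      also have "C * (t - c) * M \<le> C * (t - a) * M"
        using h(2) C(1) M0 by (intro mult_right_mono mult_left_mono) auto
      finally show ?thesis
        by (simp add: algebra_simps)
    qed
    moreover have "Q \<phi> \<in> test_fun I"
      using test_op_test_fun[OF order0_test_op[OF order0_star.hyps(2)]] .
    moreover have "\<forall>s\<le>c. Q \<phi> s = 0"
      using order0_causal[OF order0_star.hyps(2) h(3)] by blast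
    ultimately have P: "norm (P (Q \<phi>) s - p s * Q \<phi> s) \<le> B * (t - c) * ((Kq + C * (t - a)) * M)"
      using B(2) h(2,5) by blast
    have "(P \<star> Q) \<phi> s - (p * q) s * \<phi> s = (P (Q \<phi>) s - p s * Q \<phi> s) + p s * (Q \<phi> s - q s * \<phi> s)"
      by (simp add: star_def algebra_simps)
    also have "norm \<dots> \<le> B * (t - c) * ((Kq + C * (t - a)) * M) + Kp * (C * (t - c) * M)"
      using P Q[OF h(5)] Kp h(2,5)
      by (intro norm_triangle_mono) (auto simp: norm_mult intro!: mult_mono')
    finally show ?thesis
      by (simp add: algebra_simps)
  qed
  moreover have "0 \<le> B * (Kq + C * (t - a)) + Kp * C" if "a \<le> t"
    using that B(1) C(1) Kp(1) Kq(1) by simp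
  ultimately show ?case
    \<comment> \<open>For a > t the interval \<open>{a..t}\<close> is empty and every B
      works.\<close>
    by (cases "a \<le> t") (blast, auto)
qed

text \<open>
  The operators are tested on peaks at \<open>t\<close> supported to the right of \<open>c\<close>: as \<open>c\<close> tends to \<open>t\<close> from the left,
  the Volterra parts vanish like \<open>t - c\<close>. This needs points of \<open>I\<close> to the left of \<open>t\<close>.
\<close>

lemma order0_unique_at:
  assumes P: "order0 P p" and Q: "order0 Q q" and a: "a \<in> I" and t: "t \<in> I" and "a < t"
    and eq: "\<And>\<psi>. \<psi> \<in> test_fun I \<Longrightarrow> P \<psi> t = Q \<psi> t"
  shows "p t = q t"
proof -
  obtain B where B: "mult_close a t P p B"
    using order0_estimate[OF P a t] by blast
  obtain C where C: "mult_close a t Q q C"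
    using order0_estimate[OF Q a t] by blast
  have bound: "norm (p t - q t) \<le> (B + C) * (t - c)" if c: "a < c" "c < t" for c
  proof -
    have "{a<..<t} \<subseteq> interior I"
      using atLeastAtMost_subset_I[OF a t] by (intro interior_maximal) auto
    then have "c \<in> interior I"
      using c by auto
    then obtain \<psi> where \<psi>: "\<psi> \<in> test_fun I" "\<forall>s\<le>c. \<psi> s = 0" "\<forall>s\<in>{c..t}. norm (\<psi> s) \<le> 1" "\<psi> t = 1"
      using peak_test_fun[OF _ t c(2)] by blast
    have "norm (P \<psi> t - p t * \<psi> t) \<le> B * (t - c) * 1" "norm (Q \<psi> t - q t * \<psi> t) \<le> C * (t - c) * 1"
      using B[rule_format, OF \<psi>(1), of c 1 t] C[rule_format, OF \<psi>(1), of c 1 t] \<psi> c by auto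
    \<comment> \<open>Since \<psi> t = 1 and P \<psi> t = Q \<psi> t, the difference of the two
      errors is p t - q t.\<close>
    then have "norm ((Q \<psi> t - q t) - (P \<psi> t - p t)) \<le> C * (t - c) + B * (t - c)"
      using \<psi>(4) by (intro norm_triangle_le_diff) simp
    then show ?thesis
      using eq[OF \<psi>(1)] by (simp add: algebra_simps)
  qed
  have "((\<lambda>c. (B + C) * (t - c)) \<longlongrightarrow> (B + C) * (t - t)) (at_left t)"
    by (intro tendsto_intros)
  moreover have "eventually (\<lambda>c. norm (p t - q t) \<le> (B + C) * (t - c)) (at_left t)"
    using \<open>a < t\<close> bound by (auto simp: eventually_at_left)
  ultimately have "norm (p t - q t) \<le> (B + C) * (t - t)"
    by (rule tendsto_lowerbound) simp
  then show ?thesis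
    by simp
qed

section \<open>Orders and principal symbols\<close>

text \<open>Integer powers of D, the negative ones being powers of J: a single family in which
  orders of either sign add up.\<close>

definition Dpow :: "int \<Rightarrow> dist" where
  "Dpow k = (if k \<ge> 0 then ((\<star>) D_op ^^ nat k) (star_one I) else ((\<star>) J_op ^^ nat (- k)) (star_one I))"

lemma Dpow_0: "Dpow 0 = star_one I"
  by (simp add: Dpow_def)

lemma test_op_Dpow: "test_op (Dpow k)"
proof -
  have "test_op (((\<star>) P ^^ n) (star_one I))" if "test_op P" for P n
    by (induction n) (simp_all add: test_op_one test_op_star that)
  then show ?thesis
    by (simp add: Dpow_def test_op_D_op test_op_J_op)
qed

lemma D_op_star_Dpow: "D_op \<star> Dpow k = Dpow (k + 1)"
proof (cases "k \<ge> 0")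
  case True
  then show ?thesis
    by (simp add: Dpow_def nat_add_distrib)
next
  case False
  then obtain n where n: "nat (- k) = Suc n"
    by (metis not0_implies_Suc not_le zero_less_nat_eq neg_0_less_iff_less gr_implies_not0)
  have "test_op (((\<star>) J_op ^^ n) (star_one I))"
    by (induction n) (simp_all add: test_op_one test_op_star test_op_J_op)
  then have "D_op \<star> Dpow k = ((\<star>) J_op ^^ n) (star_one I)"
    using False n by (simp add: Dpow_def D_op_star_J_op star_one_left flip: star_assoc)
  also have "\<dots> = Dpow (k + 1)"
  proof (cases "n = 0")
    case True
    then have "k + 1 = 0" using n False by simp
    then show ?thesis using True by (simp add: Dpow_0)
  next
    case False
    then have "\<not> k + 1 \<ge> 0" "nat (- (k + 1)) = n" using n by auto
    then show ?thesis by (simp add: Dpow_def)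
  qed
  finally show ?thesis .
qed

lemma J_op_star_Dpow: "J_op \<star> Dpow k = Dpow (k - 1)"
proof -
  have "J_op \<star> Dpow k = J_op \<star> (D_op \<star> Dpow (k - 1))"
    by (simp add: D_op_star_Dpow)
  then show ?thesis
    by (simp add: J_op_star_D_op star_one_left test_op_Dpow flip: star_assoc)
qed

lemma Dpow_add: "Dpow k \<star> Dpow l = Dpow (k + l)"
proof (induction k rule: int_induct[where k = 0])
  case base
  then show ?case by (simp add: Dpow_0 star_one_left test_op_Dpow)
next
  case (step1 i)
  have "Dpow (i + 1) \<star> Dpow l = D_op \<star> (Dpow i \<star> Dpow l)"
    by (simp add: D_op_star_Dpow[symmetric] star_assoc)
  then show ?case
    by (simp add: step1 D_op_star_Dpow algebra_simps)
next
  case (step2 i)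
  have "Dpow (i - 1) \<star> Dpow l = J_op \<star> (Dpow i \<star> Dpow l)"
    by (simp add: J_op_star_Dpow[symmetric] star_assoc)
  then show ?case
    by (simp add: step2 J_op_star_Dpow algebra_simps)
qed

lemma Dpow_1: "Dpow 1 = D_op"
  using D_op_star_Dpow[of 0] by (simp add: Dpow_0 star_one_right test_op_D_op)

lemma Dpow_minus_1: "Dpow (- 1) = J_op"
  using J_op_star_Dpow[of 0] by (simp add: Dpow_0 star_one_right test_op_J_op)

lemma order0_conj_Dpow: "order0 P p \<Longrightarrow> \<exists>P'. order0 P' p \<and> Dpow k \<star> P = P' \<star> Dpow k"
proof (induction k rule: int_induct[where k = 0])
  case base
  then show ?case
    using order0_test_op by (auto simp: Dpow_0 star_one_left star_one_right)
next
  case (step1 i)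
  then obtain P' where P': "order0 P' p" "Dpow i \<star> P = P' \<star> Dpow i"
    by blast
  then obtain P'' where P'': "order0 P'' p" "D_op \<star> P' = P'' \<star> D_op"
    using order0_conj_D by blast
  have "Dpow (i + 1) \<star> P = P'' \<star> Dpow (i + 1)"
    by (metis D_op_star_Dpow P'(2) P''(2) star_assoc)
  then show ?case
    using P'' by blast
next
  case (step2 i)
  then obtain P' where P': "order0 P' p" "Dpow i \<star> P = P' \<star> Dpow i"
    by blast
  then obtain P'' where P'': "order0 P'' p" "J_op \<star> P' = P'' \<star> J_op"
    using order0_conj_J by blast
  have "Dpow (i - 1) \<star> P = P'' \<star> Dpow (i - 1)"
    by (metis J_op_star_Dpow P'(2) P''(2) star_assoc)
  then show ?case
    using P'' by blast
qed

text \<open>The order k is an upper bound, as p may vanish. \<open>order0\<close> carries symbols on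
  the whole line; here only their values on I count, since the operator does not see the
  others.\<close>

definition has_symbol :: "int \<Rightarrow> (real \<Rightarrow> complex) \<Rightarrow> dist \<Rightarrow> bool" where
  "has_symbol k p P \<longleftrightarrow> (\<exists>R r. order0 R r \<and> P = R \<star> Dpow k \<and> (\<forall>t\<in>I. r t = p t))"

lemma has_symbolE:
  assumes "has_symbol k p P"
  obtains R r where "order0 R r" "P = R \<star> Dpow k" "\<And>t. t \<in> I \<Longrightarrow> r t = p t"
  using assms unfolding has_symbol_def by blast

lemma has_symbolI: "order0 R r \<Longrightarrow> P = R \<star> Dpow k \<Longrightarrow> (\<And>t. t \<in> I \<Longrightarrow> r t = p t) \<Longrightarrow> has_symbol k p P"
  unfolding has_symbol_def by blast

lemma has_symbol_test_op: "has_symbol k p P \<Longrightarrow> test_op P"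
  by (elim has_symbolE) (simp add: test_op_star order0_test_op test_op_Dpow)

lemma has_symbol_smooth1: "has_symbol k p P \<Longrightarrow> smooth1 I p"
  by (elim has_symbolE) (metis smooth1_cong order0_smooth1)

lemma has_symbol_cong: "has_symbol k p P \<Longrightarrow> (\<And>t. t \<in> I \<Longrightarrow> p t = q t) \<Longrightarrow> has_symbol k q P"
  unfolding has_symbol_def by metis

lemma has_symbol_order0: "order0 P p \<Longrightarrow> has_symbol 0 p P"
  by (rule has_symbolI) (auto simp: Dpow_0 star_one_right dest: order0_test_op)

lemma has_symbol_mult_op: "smooth1 I p \<Longrightarrow> has_symbol 0 p (mult_op p)"
  by (simp add: has_symbol_order0 order0_mult)

lemma has_symbol_delta_const: "has_symbol 0 (\<lambda>_. z) (delta_const I z)"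
  by (simp add: delta_const_eq_mult_op has_symbol_mult_op smooth1_const)

lemma has_symbol_Dpow: "has_symbol k (\<lambda>_. 1) (Dpow k)"
  by (rule has_symbolI[OF order0_mult[OF smooth1_const[of 1]]])
     (simp_all add: star_one_left test_op_Dpow flip: delta_const_eq_mult_op)

lemma has_symbol_add:
  assumes "has_symbol k p P" "has_symbol k q Q"
  shows "has_symbol k (\<lambda>t. p t + q t) (P + Q)"
proof -
  obtain R r where R: "order0 R r" "P = R \<star> Dpow k" "\<And>t. t \<in> I \<Longrightarrow> r t = p t"
    using assms(1) by (rule has_symbolE) blast
  obtain S s where S: "order0 S s" "Q = S \<star> Dpow k" "\<And>t. t \<in> I \<Longrightarrow> s t = q t"
    using assms(2) by (rule has_symbolE) blast
  show ?thesis
    by (rule has_symbolI[OF order0_add[OF R(1) S(1)]]) (simp_all add: R S star_add_left)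
qed

text \<open>D^k is moved past the order-zero part of Q; this conjugation keeps the symbol.\<close>

lemma has_symbol_star:
  assumes "has_symbol k p P" "has_symbol l q Q"
  shows "has_symbol (k + l) (\<lambda>t. p t * q t) (P \<star> Q)"
proof -
  obtain R r where R: "order0 R r" "P = R \<star> Dpow k" "\<And>t. t \<in> I \<Longrightarrow> r t = p t"
    using assms(1) by (rule has_symbolE) blast
  obtain S s where S: "order0 S s" "Q = S \<star> Dpow l" "\<And>t. t \<in> I \<Longrightarrow> s t = q t"
    using assms(2) by (rule has_symbolE) blast
  obtain S' where S': "order0 S' s" "Dpow k \<star> S = S' \<star> Dpow k"
    using order0_conj_Dpow[OF S(1)] by blast
  have "P \<star> Q = (R \<star> S') \<star> Dpow (k + l)"
    unfolding R(2) S(2) by (metis S'(2) Dpow_add star_assoc)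
  then show ?thesis
    by (rule has_symbolI[OF order0_star[OF R(1) S'(1)]]) (simp add: R S)
qed

lemma has_symbol_uminus:
  assumes "has_symbol k p P"
  shows "has_symbol k (\<lambda>t. - p t) (- P)"
  using has_symbol_star[OF has_symbol_mult_op[OF smooth1_const[of "-1"]] assms]
  by (simp add: mult_op_minus_one_star has_symbol_test_op[OF assms])

lemma has_symbol_diff:
  assumes "has_symbol k p P" "has_symbol k q Q"
  shows "has_symbol k (\<lambda>t. p t - q t) (P - Q)"
  using has_symbol_add[OF assms(1) has_symbol_uminus[OF assms(2)]]
  by (simp only: add_uminus_conv_diff)

lemma has_symbol_0: "has_symbol k (\<lambda>_. 0) 0"
proof -
  have "0 = mult_op (\<lambda>_. 0) \<star> Dpow k"
    by (simp add: mult_op_def star_def fun_eq_iff)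
  then show ?thesis
    by (rule has_symbolI[OF order0_mult[OF smooth1_const[of 0]]]) simp
qed

lemma has_symbol_sum:
  assumes "\<And>i. i \<in> S \<Longrightarrow> has_symbol k (p i) (P i)"
  shows "has_symbol k (\<lambda>t. \<Sum>i\<in>S. p i t) (\<Sum>i\<in>S. P i)"
  using assms
proof (induction S rule: infinite_finite_induct)
  case (insert x F)
  have "has_symbol k (\<lambda>t. p x t + (\<Sum>i\<in>F. p i t)) (P x + (\<Sum>i\<in>F. P i))"
    using insert by (intro has_symbol_add) auto
  then show ?case
    by (simp only: sum.insert[OF insert(1,2)])
qed (simp_all only: sum.infinite sum.empty has_symbol_0 not_False_eq_True)

text \<open>R D^k = (R D^(k-l)) D^l, where D^(k-l) is a positive power of J and hence has symbol
  0.\<close>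

lemma has_symbol_lift: "has_symbol k p P \<Longrightarrow> k < l \<Longrightarrow> has_symbol l (\<lambda>_. 0) P"
proof -
  assume P: "has_symbol k p P" and "k < l"
  then obtain R r where R: "order0 R r" "P = R \<star> Dpow k"
    using has_symbolE by metis
  have J: "order0 (((\<star>) J_op ^^ Suc n) (star_one I)) 0" for n
  proof (induction n)
    case 0
    show ?case using order0_J_op by (simp only: funpow.simps o_apply id_apply star_one_right[OF test_op_J_op])
  next
    case (Suc n)
    show ?case using order0_star[OF order0_J_op Suc] by (simp only: funpow.simps o_apply mult_zero_left)
  qed
  have "order0 (Dpow (k - l)) 0"
    using J[of "nat (l - k) - 1"] \<open>k < l\<close> by (simp add: Dpow_def Suc_diff_Suc del: funpow.simps)
  moreover have "P = (R \<star> Dpow (k - l)) \<star> Dpow l"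
    by (simp add: R Dpow_add star_assoc)
  ultimately show ?thesis
    using R(1) by (intro has_symbolI[OF order0_star]) (auto simp: zero_fun_def)
qed

text \<open>Insert D J = 1 on the right and integrate K D by parts.\<close>

lemma has_symbol_theta_distr:
  assumes "smooth2 I K"
  shows "has_symbol (- 1) (\<lambda>t. K t t) (theta_distr I K)"
proof -
  have "theta_distr I K = (theta_distr I K \<star> D_op) \<star> J_op"
    by (simp add: star_assoc D_op_star_J_op star_one_right test_op_theta_distr assms)
  then have "theta_distr I K =
      (mult_op (\<lambda>t. K t t) + mult_op (\<lambda>_. -1) \<star> theta_distr I (deriv01 I K)) \<star> Dpow (- 1)"
    by (simp only: theta_distr_star_D_op'[OF assms] Dpow_minus_1)
  moreover have "order0 (mult_op (\<lambda>t. K t t) + mult_op (\<lambda>_. -1) \<star> theta_distr I (deriv01 I K))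
      ((\<lambda>t. K t t) + (\<lambda>_. -1) * 0)"
    using assms by (intro order0.intros smooth1_diag smooth1_const smooth2_deriv01)
  ultimately show ?thesis
    by (intro has_symbolI) auto
qed

text \<open>With zero diagonal, K D is again a Volterra operator, which has order -1 itself and so
  supplies a second factor J.\<close>

lemma has_symbol_theta_distr_zero_diag:
  assumes K: "smooth2 I K" and z: "\<And>t. t \<in> I \<Longrightarrow> K t t = 0"
  shows "has_symbol (- 2) (\<lambda>t. - deriv01 I K t t) (theta_distr I K)"
proof -
  have "mult_op (\<lambda>t. K t t) = 0"
    using z test_funD(2) by (fastforce simp: mult_op_def fun_eq_iff)
  have "theta_distr I K = (theta_distr I K \<star> D_op) \<star> J_op"
    by (simp add: star_assoc D_op_star_J_op star_one_right test_op_theta_distr K)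
  also have "theta_distr I K \<star> D_op = - theta_distr I (deriv01 I K)"
    using theta_distr_star_D_op'[OF K] \<open>mult_op _ = 0\<close>
    by (simp only: mult_op_minus_one_star[OF test_op_theta_distr[OF smooth2_deriv01[OF K]]] add_0_left)
  finally have *: "theta_distr I K = - theta_distr I (deriv01 I K) \<star> J_op" .
  have "has_symbol (- 1 + - 1) (\<lambda>t. - deriv01 I K t t * 1) (- theta_distr I (deriv01 I K) \<star> J_op)"
    by (intro has_symbol_star has_symbol_uminus has_symbol_theta_distr smooth2_deriv01 smooth2_const K)
  then show ?thesis
    using * by simp
qed

text \<open>The kernel is constantly 0 along the diagonal, and its derivative there is the sum of
  the two partials. This links the conditions on the two partial derivatives of \<beta>.\<close>

lemma deriv10_add_deriv01_zero_diag:
  assumes K: "smooth2 I K" and z: "\<And>t. t \<in> I \<Longrightarrow> K t t = 0" and t: "t \<in> I"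
  shows "deriv10 I K t t + deriv01 I K t t = 0"
proof -
  have "((\<lambda>s. K s s) has_vector_derivative 0) (at t within I)"
    using has_vector_derivative_const t z by (rule has_vector_derivative_transform[rotated 2])
  then show ?thesis
    using has_vector_derivative_smooth2_diag[OF K t] vector_derivative_within_I t by metis
qed

section \<open>Delta terms and members of class D\<close>

definition delta_op :: "(real \<Rightarrow> real \<Rightarrow> complex) \<Rightarrow> nat \<Rightarrow> dist" where
  "delta_op c i = (\<lambda>\<phi> t. if \<phi> \<in> test_fun I \<and> t \<in> I then nderiv I i (\<lambda>\<tau>. c t \<tau> * \<phi> \<tau>) t else 0)"

lemma distr_eq_theta_plus_delta: "distr I f M c = theta_distr I f + (\<Sum>i\<le>M. delta_op (c i) i)"
proof -
  have sum_apply: "(\<Sum>i\<in>S. P i) \<phi> t = (\<Sum>i\<in>S. P i \<phi> t)" for P :: "nat \<Rightarrow> dist" and S \<phi> t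
    by (induction S rule: infinite_finite_induct) auto
  have "theta_distr I f \<phi> t = (if \<phi> \<in> test_fun I \<and> t \<in> I
      then integral I (\<lambda>\<tau>. f t \<tau> * Heaviside (t - \<tau>) * \<phi> \<tau>) else 0)" for \<phi> t
    by (simp add: theta_distr_def distr_def)
  then show ?thesis
    by (intro ext) (auto simp: sum_apply distr_def delta_op_def intro!: sum.neutral[symmetric])
qed

text \<open>The innermost derivative either falls on the coefficient, leaving i derivatives, or on
  the test function, where it becomes a factor D on the right.\<close>

lemma delta_op_Suc:
  assumes "smooth2 I c"
  shows "delta_op c (Suc i) = delta_op (deriv01 I c) i + delta_op c i \<star> D_op"
proof -
  have nderiv_zero: "nderiv I i (\<lambda>_. 0) t = 0" if "t \<in> I" for t
    using nderiv_add[OF smooth1_const[of 0] smooth1_const[of 0] that, of i] by simp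
  moreover have "nderiv I (Suc i) (\<lambda>\<tau>. c t \<tau> * \<phi> \<tau>) t =
      nderiv I i (\<lambda>\<tau>. deriv01 I c t \<tau> * \<phi> \<tau>) t + nderiv I i (\<lambda>\<tau>. c t \<tau> * D_op \<phi> \<tau>) t"
    if \<phi>: "\<phi> \<in> test_fun I" and t: "t \<in> I" for \<phi> t
  proof -
    have "nderiv I (Suc i) (\<lambda>\<tau>. c t \<tau> * \<phi> \<tau>) t =
        nderiv I i (\<lambda>s. vector_derivative (\<lambda>\<tau>. c t \<tau> * \<phi> \<tau>) (at s within I)) t"
      by (simp only: nderiv_Suc_shift)
    also have "\<dots> = nderiv I i (\<lambda>s. deriv01 I c t s * \<phi> s + c t s * D_op \<phi> s) t"
    proof (rule nderiv_cong[OF _ t])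
      fix s assume s: "s \<in> I"
      have "((\<lambda>\<tau>. c t \<tau> * \<phi> \<tau>) has_vector_derivative c t s * D_op \<phi> s + deriv01 I c t s * \<phi> s) (at s within I)"
        using assms s t \<phi>
        by (intro has_vector_derivative_mult smooth2_has_vector_derivative01 D_op_has_vector_derivative)
      then show "vector_derivative (\<lambda>\<tau>. c t \<tau> * \<phi> \<tau>) (at s within I) = deriv01 I c t s * \<phi> s + c t s * D_op \<phi> s"
        using s by (simp add: vector_derivative_within_I add.commute)
    qed
    also have "\<dots> = nderiv I i (\<lambda>s. deriv01 I c t s * \<phi> s) t + nderiv I i (\<lambda>s. c t s * D_op \<phi> s) t"
      using assms \<phi> t
      by (intro nderiv_add smooth1_mult smooth1_slice smooth2_deriv01 test_funD(1) D_op_test_fun)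
    finally show ?thesis .
  qed
  then show ?thesis
    using test_op_test_fun[OF test_op_D_op] test_opD(1)[OF test_op_D_op] nderiv_zero
    by (intro ext) (simp add: delta_op_def star_def del: nderiv.simps)
qed

lemma has_symbol_delta_op:
  assumes "smooth2 I c"
  shows "has_symbol (int i) (\<lambda>t. c t t) (delta_op c i)"
  using assms
proof (induction i arbitrary: c)
  case 0
  have "delta_op c 0 = mult_op (\<lambda>t. c t t)"
    by (auto simp: delta_op_def mult_op_def fun_eq_iff test_funD(2))
  then show ?case
    using has_symbol_mult_op smooth1_diag[OF 0] by simp
next
  case (Suc i)
  have "has_symbol (int i + 1) (\<lambda>t. 0 + c t t * 1) (delta_op (deriv01 I c) i + delta_op c i \<star> Dpow 1)"
    using Suc.prems
    by (intro has_symbol_add has_symbol_star has_symbol_Dpow Suc.IH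
        has_symbol_lift[OF Suc.IH[OF smooth2_deriv01]]) auto
  then show ?case
    unfolding delta_op_Suc[OF Suc.prems] Dpow_1 by (simp only: of_nat_Suc add.commute add_0_left add_0_right mult_1_right)
qed

text \<open>All terms have order at most the number of delta derivatives, so one order more is a
  common order in which each has symbol 0. Only the existence of some finite order is used
  later.\<close>

lemma class_D_has_symbol:
  assumes "g \<in> class_D I"
  obtains M p where "has_symbol (int M) p g"
proof -
  obtain f M c where g: "g = distr I f M c" and f: "smooth2 I f" and c: "\<And>i. i \<le> M \<Longrightarrow> smooth2 I (c i)"
    using assms by (auto simp: class_D_def)
  have "has_symbol (int M + 1) (\<lambda>t. 0 + (\<Sum>i\<le>M. 0)) (theta_distr I f + (\<Sum>i\<le>M. delta_op (c i) i))"
    by (intro has_symbol_add has_symbol_sum has_symbol_lift[OF has_symbol_theta_distr[OF f]]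
        has_symbol_lift[OF has_symbol_delta_op[OF c]]) auto
  then show ?thesis
    using that[of "M + 1"] g distr_eq_theta_plus_delta by (simp add: add.commute)
qed

section \<open>Uniqueness of symbols\<close>

lemma has_symbol_unique_at:
  assumes P: "has_symbol k p P" and Q: "has_symbol k q Q"
    and t: "t \<in> I" and a: "a \<in> I" "a < t"
    and eq: "\<And>\<psi>. \<psi> \<in> test_fun I \<Longrightarrow> P \<psi> t = Q \<psi> t"
  shows "p t = q t"
proof -
  obtain R r where R: "order0 R r" "P = R \<star> Dpow k" "\<And>t. t \<in> I \<Longrightarrow> r t = p t"
    using P by (rule has_symbolE) blast
  obtain S s where S: "order0 S s" "Q = S \<star> Dpow k" "\<And>t. t \<in> I \<Longrightarrow> s t = q t"
    using Q by (rule has_symbolE) blast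
  \<comment> \<open>Testing both operators on D^(-k) \<psi>, which is again a test function, removes
    the factor D^k.\<close>
  have "R \<psi> t = S \<psi> t" if "\<psi> \<in> test_fun I" for \<psi>
  proof -
    have "Dpow k (Dpow (- k) \<psi>) = \<psi>"
      using Dpow_add[of k "- k"] that
      by (simp add: Dpow_0 star_def fun_eq_iff delta_const_eq_mult_op mult_op_def)
    then show ?thesis
      using eq[OF test_op_test_fun[OF test_op_Dpow, of "- k" \<psi>]] R(2) S(2) by (simp add: star_def)
  qed
  then have "r t = s t"
    using order0_unique_at[OF R(1) S(1) a(1) t a(2)] by blast
  then show ?thesis
    using R(3) S(3) t by simp
qed

text \<open>Peaks to the left of t are available only if I has points there. A left endpoint
  belonging to I is reached as a limit, for conditions given by a closed set.\<close>

lemma continuous_on_closed_from_nonleft: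
  fixes h :: "real \<Rightarrow> complex"
  assumes h: "continuous_on I h" and S: "closed S"
    and in_S: "\<And>t a. t \<in> I \<Longrightarrow> a \<in> I \<Longrightarrow> a < t \<Longrightarrow> h t \<in> S" and t: "t \<in> I"
  shows "h t \<in> S"
proof (cases "\<exists>a\<in>I. a < t")
  case True
  then show ?thesis using in_S t by blast
next
  case False
  have "(h \<longlongrightarrow> h t) (at t within I)"
    using h t by (simp add: continuous_on_def)
  moreover have "eventually (\<lambda>s. h s \<in> S) (at t within I)"
    unfolding eventually_at_filter using in_S t False
    by (intro always_eventually) (metis linorder_neqE_linordered_idom)
  ultimately show ?thesis
    using Lim_in_closed_set[OF S] at_within_I_neq_bot[OF t] by blast
qed

lemma has_symbol_unique:
  assumes P: "has_symbol k p P" "has_symbol k q P" and t: "t \<in> I"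
  shows "p t = q t"
proof -
  have "p t - q t \<in> {0}"
  proof (rule continuous_on_closed_from_nonleft[OF _ _ _ t])
    show "continuous_on I (\<lambda>t. p t - q t)"
      using P by (intro continuous_on_diff smooth1_continuous_on has_symbol_smooth1)
    show "p s - q s \<in> {0}" if "s \<in> I" "a \<in> I" "a < s" for s a
      using has_symbol_unique_at[OF P that] by simp
  qed simp
  then show ?thesis
    by simp
qed

text \<open>R D^k = (R D) D^(k-1), and R D splits into its leading term and a remainder of order
  zero.\<close>

lemma has_symbol_reduce:
  assumes "has_symbol k p P"
  obtains S s where "has_symbol (k - 1) s S" "P = mult_op p \<star> Dpow k + S"
proof -
  obtain R r where R: "order0 R r" "P = R \<star> Dpow k" "\<And>t. t \<in> I \<Longrightarrow> r t = p t"
    using assms by (rule has_symbolE) blast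
  obtain S s where S: "order0 S s" "R \<star> D_op = mult_op r \<star> D_op + S"
    using order0_star_D_op[OF R(1)] by blast
  have "P = (R \<star> D_op) \<star> Dpow (k - 1)"
    by (simp add: R(2) star_assoc D_op_star_Dpow)
  also have "\<dots> = mult_op r \<star> Dpow k + S \<star> Dpow (k - 1)"
    by (simp add: S(2) star_add_left star_assoc D_op_star_Dpow)
  also have "mult_op r = mult_op p"
    using R(3) by (auto simp: mult_op_def fun_eq_iff test_funD(2)) (metis test_funD(2))
  finally show ?thesis
    using that has_symbolI[OF S(1) refl] by blast
qed

lemma zero_symbol_reduce:
  assumes "has_symbol k p P" "\<And>t. t \<in> I \<Longrightarrow> p t = 0"
  obtains s where "has_symbol (k - 1) s P"
proof -
  obtain S s where S: "has_symbol (k - 1) s S" "P = mult_op p \<star> Dpow k + S"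
    using has_symbol_reduce[OF assms(1)] .
  have "mult_op p \<star> Dpow k = 0"
    using assms(2) test_op_outside[OF test_op_Dpow] by (auto simp: mult_op_def star_def fun_eq_iff)
  then show ?thesis
    using S that by simp
qed

section \<open>Symbols of *-inverses\<close>

text \<open>
  Here \<open>q\<close> is the coefficient of \<open>D\<^sup>2\<close> in \<open>g = p D\<^sup>2\<^sup>+\<^sup>m + \<dots> + q D\<^sup>2 + \<dots>\<close>. The higher coefficients may be nonzero
  elsewhere, but they vanish one after the other at every point \<open>t\<close> with \<open>f t \<noteq> 0\<close>. Multiplication from the
  left acts pointwise, which is why the claim can be localised at \<open>t\<close>.
\<close>

lemma left_inverse_symbol_dichotomy:
  assumes \<beta>: "has_symbol (- 2) f \<beta>" and g: "has_symbol (2 + int m) p g"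
  shows "\<exists>q. continuous_on I q \<and> (\<forall>t\<in>I. \<forall>a\<in>I. a < t \<longrightarrow> f t \<noteq> 0 \<longrightarrow>
    (\<forall>\<phi>\<in>test_fun I. (g \<star> \<beta>) \<phi> t = \<phi> t) \<longrightarrow> q t * f t = 1)"
  using g
proof (induction m arbitrary: g p)
  case 0
  have "p t * f t = 1" if "t \<in> I" "a \<in> I" "a < t" "\<forall>\<phi>\<in>test_fun I. (g \<star> \<beta>) \<phi> t = \<phi> t" for t a
  proof (rule has_symbol_unique_at[where P = "g \<star> \<beta>" and Q = "star_one I"])
    show "has_symbol 0 (\<lambda>t. p t * f t) (g \<star> \<beta>)"
      using has_symbol_star[OF 0 \<beta>] by simp
    show "has_symbol 0 (\<lambda>_. 1) (star_one I)"
      by (rule has_symbol_delta_const)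
    show "(g \<star> \<beta>) \<psi> t = star_one I \<psi> t" if "\<psi> \<in> test_fun I" for \<psi>
      using that \<open>\<forall>\<phi>\<in>test_fun I. _\<close> by (simp add: delta_const_eq_mult_op mult_op_def)
  qed (use that in auto)
  then show ?case
    using 0 has_symbol_smooth1 smooth1_continuous_on by blast
next
  case (Suc m)
  obtain h s where h: "has_symbol (2 + int (Suc m) - 1) s h" "g = mult_op p \<star> Dpow (2 + int (Suc m)) + h"
    using has_symbol_reduce[OF Suc.prems] .
  then have "has_symbol (2 + int m) s h"
    by simp
  then obtain q where q: "continuous_on I q" "\<And>t a. t \<in> I \<Longrightarrow> a \<in> I \<Longrightarrow> a < t \<Longrightarrow> f t \<noteq> 0 \<Longrightarrow>
    (\<forall>\<phi>\<in>test_fun I. (h \<star> \<beta>) \<phi> t = \<phi> t) \<Longrightarrow> q t * f t = 1"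
    using Suc.IH by blast
  have "q t * f t = 1"
    if t: "t \<in> I" "a \<in> I" "a < t" "f t \<noteq> 0" and eq: "\<forall>\<phi>\<in>test_fun I. (g \<star> \<beta>) \<phi> t = \<phi> t" for t a
  proof -
    have "p t * f t = 0"
    proof (rule has_symbol_unique_at[where P = "g \<star> \<beta>" and Q = "star_one I"])
      show "has_symbol (1 + int m) (\<lambda>t. p t * f t) (g \<star> \<beta>)"
        using has_symbol_star[OF Suc.prems \<beta>] by (simp add: algebra_simps)
      show "has_symbol (1 + int m) (\<lambda>_. 0) (star_one I)"
        by (rule has_symbol_lift[OF has_symbol_delta_const]) simp
      show "(g \<star> \<beta>) \<psi> t = star_one I \<psi> t" if "\<psi> \<in> test_fun I" for \<psi>
        using that eq by (simp add: delta_const_eq_mult_op mult_op_def)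
    qed (use t in auto)
    then have "p t = 0"
      using t by simp
    then have "(g \<star> \<beta>) \<phi> t = (h \<star> \<beta>) \<phi> t" for \<phi>
      by (simp add: h(2) star_def mult_op_def)
    then show ?thesis
      using q(2) t eq by metis
  qed
  then show ?case
    using q(1) by blast
qed

lemma left_inverse_symbol_nonzero:
  assumes \<beta>: "has_symbol (- 2) f \<beta>" and g: "has_symbol (2 + int m) p g" and inv: "g \<star> \<beta> = star_one I"
    and nz: "\<exists>t\<in>I. f t \<noteq> 0" and t: "t \<in> I"
  shows "f t \<noteq> 0"
proof -
  have "(g \<star> \<beta>) \<phi> t = \<phi> t" if "\<phi> \<in> test_fun I" for \<phi> t
    using that unfolding inv by (simp add: delta_const_eq_mult_op mult_op_def)
  then obtain q where q: "continuous_on I q"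
    "\<And>t a. t \<in> I \<Longrightarrow> a \<in> I \<Longrightarrow> a < t \<Longrightarrow> f t \<noteq> 0 \<Longrightarrow> q t * f t = 1"
    using left_inverse_symbol_dichotomy[OF \<beta> g] by blast
  have f: "continuous_on I f"
    using \<beta> has_symbol_smooth1 smooth1_continuous_on by blast
  have qf: "continuous_on I (\<lambda>t. q t * f t)"
    using q(1) f by (rule continuous_on_mult)
  \<comment> \<open>At points with part of I to their left, q f is 1 where f is nonzero and
    trivially 0 elsewhere; a left endpoint follows by closedness.\<close>
  have two: "q s * f s \<in> {0, 1}" if "s \<in> I" for s
    by (rule continuous_on_closed_from_nonleft[OF qf _ _ that]) (use q(2) in auto)
  have "finite ((\<lambda>t. q t * f t) ` I)"
    by (rule finite_subset[of _ "{0, 1}"]) (use two in blast)+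
  then have "(\<lambda>t. q t * f t) constant_on I"
    by (rule continuous_finite_range_constant[OF convex_connected[OF convex_I] qf])
  then obtain z where z: "\<And>s. s \<in> I \<Longrightarrow> q s * f s = z"
    unfolding constant_on_def by blast
  \<comment> \<open>The constant is evaluated where q f = 1 is known, which requires points of I to
    the left. If f vanished at all such points, continuity would make it vanish identically.\<close>
  have "\<exists>s\<in>I. \<exists>a\<in>I. a < s \<and> f s \<noteq> 0"
  proof (rule ccontr)
    assume "\<not> ?thesis"
    then have "f s \<in> {0}" if "s \<in> I" for s
      by (intro continuous_on_closed_from_nonleft[OF f _ _ that]) auto
    then show False
      using nz by blast
  qed
  then have "z = 1"
    using q(2) z by metis
  then show ?thesis
    using z[OF t] by auto
qed

text \<open>Descent on the order. Above order 2 the product with \<beta> is counted with positive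
  order, in which the unit has symbol 0; so p f = 0, hence p = 0 and the order drops. At order 2 the
  comparison reads p f = 1.\<close>

lemma left_inverse_has_symbol:
  assumes \<beta>: "has_symbol (- 2) f \<beta>" and g: "has_symbol (2 + int m) p g" and inv: "g \<star> \<beta> = star_one I"
    and nz: "\<And>t. t \<in> I \<Longrightarrow> f t \<noteq> 0"
  shows "has_symbol 2 (\<lambda>t. inverse (f t)) g"
  using g
proof (induction m arbitrary: p)
  case 0
  have "has_symbol 0 (\<lambda>t. p t * f t) (star_one I)"
    using has_symbol_star[OF 0 \<beta>] by (simp add: inv)
  then have "p t * f t = 1" if "t \<in> I" for t
    using has_symbol_unique[OF _ has_symbol_delta_const that] by blast
  then have "p t = inverse (f t)" if "t \<in> I" for t
    using nz that by (metis inverse_unique mult.commute)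
  then show ?case
    using has_symbol_cong[OF 0] by simp
next
  case (Suc m)
  have "has_symbol (1 + int m) (\<lambda>t. p t * f t) (star_one I)"
    using has_symbol_star[OF Suc.prems \<beta>] by (simp add: inv algebra_simps)
  moreover have "has_symbol (1 + int m) (\<lambda>_. 0) (star_one I)"
    by (rule has_symbol_lift[OF has_symbol_delta_const]) simp
  ultimately have "p t * f t = 0" if "t \<in> I" for t
    using has_symbol_unique that by blast
  then have "p t = 0" if "t \<in> I" for t
    using nz that by simp
  then obtain s where "has_symbol (2 + int (Suc m) - 1) s g"
    using zero_symbol_reduce[OF Suc.prems] by blast
  then show ?case
    using Suc.IH by simp
qed

text \<open>The usual uniqueness argument h = h \<beta> g = g. Its unit laws hold for operators on
  test functions, and members of class D are such operators because they have an order.\<close>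

lemma is_star_inverse_star_inv:
  assumes "star_invertible I \<beta>"
  shows "is_star_inverse I \<beta> (star_inv I \<beta>)"
proof -
  obtain g where g: "is_star_inverse I \<beta> g"
    using assms by (auto simp: star_invertible_def)
  have "h = g" if h: "is_star_inverse I \<beta> h" for h
  proof -
    have "test_op h" "test_op g"
      using g h class_D_has_symbol has_symbol_test_op unfolding is_star_inverse_def by metis+
    then show ?thesis
      using g h unfolding is_star_inverse_def by (metis star_one_left star_one_right star_assoc)
  qed
  then show ?thesis
    unfolding star_inv_def using theI[of "is_star_inverse I \<beta>", OF g] by blast
qed

lemma star_inv_has_symbol:
  assumes \<beta>: "has_symbol (- 2) f \<beta>" and inv: "star_invertible I \<beta>" and nz: "\<exists>t\<in>I. f t \<noteq> 0"
  shows "\<forall>t\<in>I. f t \<noteq> 0" and "has_symbol 2 (\<lambda>t. inverse (f t)) (star_inv I \<beta>)"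
proof -
  define g where "g = star_inv I \<beta>"
  have g: "g \<in> class_D I" "g \<star> \<beta> = star_one I"
    using is_star_inverse_star_inv[OF inv] by (auto simp: g_def is_star_inverse_def)
  then obtain M p where "has_symbol (int M) p g"
    using class_D_has_symbol by blast
  \<comment> \<open>M may be below 2. Raising the order to 2 + M, with symbol 0, brings g into the
    form required for the descent.\<close>
  then have h: "has_symbol (2 + int M) (\<lambda>_. 0) g"
    by (rule has_symbol_lift) simp
  show *: "\<forall>t\<in>I. f t \<noteq> 0"
    using left_inverse_symbol_nonzero[OF \<beta> h g(2) nz] by blast
  show "has_symbol 2 (\<lambda>t. inverse (f t)) (star_inv I \<beta>)"
    using left_inverse_has_symbol[OF \<beta> h g(2)] * g_def by blast
qed

section \<open>Symbols in the *-Lanczos algorithm\<close>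

lemma has_symbol_star_mm:
  assumes "\<And>r s. has_symbol i (\<lambda>t. M t $ r $ s) (A $ r $ s)" "\<And>r s. has_symbol j (\<lambda>t. N t $ r $ s) (B $ r $ s)"
  shows "has_symbol (i + j) (\<lambda>t. (M t ** N t) $ r $ s) ((A \<star>\<star> B) $ r $ s)"
  unfolding star_mm_def matrix_matrix_mult_def vec_lambda_beta
  by (intro has_symbol_sum has_symbol_star assms)

lemma has_symbol_star_vm:
  assumes "\<And>r. has_symbol k (\<lambda>t. x t $ r) (X $ r)" "\<And>r s. has_symbol i (\<lambda>t. M t $ r $ s) (A $ r $ s)"
  shows "has_symbol (k + i) (\<lambda>t. (x t v* M t) $ r) ((X v\<star> A) $ r)"
proof -
  have "has_symbol (k + i) (\<lambda>t. \<Sum>s\<in>UNIV. x t $ s * M t $ s $ r) ((X v\<star> A) $ r)"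
    unfolding star_vm_def vec_lambda_beta by (intro has_symbol_sum has_symbol_star assms)
  then show ?thesis
    by (simp add: vector_matrix_mult_def mult.commute)
qed

lemma has_symbol_star_mv:
  assumes "\<And>r s. has_symbol i (\<lambda>t. M t $ r $ s) (A $ r $ s)" "\<And>r. has_symbol k (\<lambda>t. x t $ r) (X $ r)"
  shows "has_symbol (i + k) (\<lambda>t. (M t *v x t) $ r) ((A \<star>v X) $ r)"
  unfolding star_mv_def matrix_vector_mult_def vec_lambda_beta
  by (intro has_symbol_sum has_symbol_star assms)

lemma has_symbol_star_vv:
  assumes "\<And>r. has_symbol k (\<lambda>t. x t $ r) (X $ r)" "\<And>r. has_symbol l (\<lambda>t. y t $ r) (Y $ r)"
  shows "has_symbol (k + l) (\<lambda>t. rowcol (x t) (y t)) (X v\<star>v Y)"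
  unfolding star_vv_def rowcol_def
  by (intro has_symbol_sum has_symbol_star assms)

lemma has_symbol_star_sv:
  assumes "has_symbol i c \<gamma>" "\<And>r. has_symbol k (\<lambda>t. x t $ r) (X $ r)"
  shows "has_symbol (i + k) (\<lambda>t. (c t *s x t) $ r) ((\<gamma> \<star>s X) $ r)"
  unfolding star_sv_def vector_scalar_mult_def vec_lambda_beta
  by (intro has_symbol_star assms)

lemma has_symbol_star_vs:
  assumes "\<And>r. has_symbol k (\<lambda>t. x t $ r) (X $ r)" "has_symbol i c \<gamma>"
  shows "has_symbol (k + i) (\<lambda>t. (c t *s x t) $ r) ((X s\<star> \<gamma>) $ r)"
proof -
  have "has_symbol (k + i) (\<lambda>t. x t $ r * c t) ((X s\<star> \<gamma>) $ r)"
    unfolding star_vs_def vec_lambda_beta by (intro has_symbol_star assms)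
  then show ?thesis
    by (simp add: mult.commute)
qed

lemma has_symbol_vec_diff:
  assumes "has_symbol k (\<lambda>t. x t $ r) (X $ r)" "has_symbol k (\<lambda>t. y t $ r) (Y $ r)"
  shows "has_symbol k (\<lambda>t. (x t - y t) $ r) ((X - Y) $ r)"
  unfolding vector_minus_component using assms by (rule has_symbol_diff)

end

locale lanczos = time_interval +
  fixes At :: "real \<Rightarrow> complex^'n^'n" and w v :: "complex^'n"
  assumes smooth_At: "\<And>i j. smooth1 I (\<lambda>t. At t $ i $ j)"
begin

abbreviation "A \<equiv> theta_matrix I At"

text \<open>The orders follow from A having order -1: each step lowers the order of w by 1, while v
  gains -1 + 2 = 1, the 2 coming from the *-inverse of \<beta>.\<close>

abbreviation "w_symbol m \<equiv> \<forall>i. has_symbol (- int m) (\<lambda>t. ul_w (At t) w v m $ i) (sl_w I A w v m $ i)"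

abbreviation "v_symbol m \<equiv> \<forall>i. has_symbol (int m) (\<lambda>t. ul_v (At t) w v m $ i) (sl_v I A w v m $ i)"

abbreviation "beta_symbol m \<equiv> has_symbol (- 2) (\<lambda>t. ul_b (At t) w v m) (sl_beta I A w v m)"

abbreviation "beta_inv_symbol m \<equiv>
  has_symbol 2 (\<lambda>t. inverse (ul_b (At t) w v m)) (star_inv I (sl_beta I A w v m))"

lemma A_symbol: "has_symbol (- 1) (\<lambda>t. At t $ i $ j) (A $ i $ j)"
  using has_symbol_theta_distr[OF smooth2_fst[OF smooth_At]] by (simp add: theta_matrix_def)

lemma w0_symbol: "has_symbol 0 (\<lambda>t. ul_w (At t) w v 0 $ i) (sl_w I A w v 0 $ i)"
  and v0_symbol: "has_symbol 0 (\<lambda>t. ul_v (At t) w v 0 $ i) (sl_v I A w v 0 $ i)"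
  by (simp_all add: has_symbol_delta_const)

lemma w_symbol_0: "w_symbol 0" and v_symbol_0: "v_symbol 0"
  using w0_symbol v0_symbol by simp_all

lemma alpha_symbol:
  assumes "w_symbol m" "v_symbol m"
  shows "has_symbol (- 1) (\<lambda>t. ul_a (At t) w v m) (sl_alpha I A w v m)"
proof -
  have "has_symbol (- int m + - 1 + int m) (\<lambda>t. rowcol (ul_w (At t) w v m v* At t) (ul_v (At t) w v m))
      ((sl_w I A w v m v\<star> A) v\<star>v sl_v I A w v m)"
    using assms by (intro has_symbol_star_vv has_symbol_star_vm A_symbol) blast+
  then show ?thesis
    by (simp only: ul_a.simps sl_alpha.simps) simp
qed

lemma w_symbol_1: "w_symbol (Suc 0)"
proof
  fix i
  have "has_symbol (0 + - 1) (\<lambda>t. (ul_w (At t) w v 0 v* At t) $ i) ((sl_w I A w v 0 v\<star> A) $ i)"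
    using w0_symbol by (intro has_symbol_star_vm A_symbol) blast+
  moreover have "has_symbol (- 1 + 0) (\<lambda>t. (ul_a (At t) w v 0 *s ul_w (At t) w v 0) $ i)
      ((sl_alpha I A w v 0 \<star>s sl_w I A w v 0) $ i)"
    using w0_symbol by (intro has_symbol_star_sv alpha_symbol w_symbol_0 v_symbol_0) blast+
  ultimately show "has_symbol (- int (Suc 0)) (\<lambda>t. ul_w (At t) w v (Suc 0) $ i) (sl_w I A w v (Suc 0) $ i)"
    unfolding ul_w.simps(2) sl_w.simps(2) by (intro has_symbol_vec_diff) (simp_all only: add_0_left add_0_right of_nat_Suc of_nat_0)
qed

text \<open>The first \<beta> is defined through the square of A, but b_1 through w_1. Expanding w_1
  and using that w^H M v is a_0 identifies the two expressions.\<close>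

lemma beta_symbol_1: "beta_symbol (Suc 0)"
proof -
  have "has_symbol (0 + (- 1 + - 1) + 0)
      (\<lambda>t. rowcol (ul_w (At t) w v 0 v* (At t ** At t)) (ul_v (At t) w v 0))
      ((sl_w I A w v 0 v\<star> (A \<star>\<star> A)) v\<star>v sl_v I A w v 0)"
    using w0_symbol v0_symbol
    by (intro has_symbol_star_vv has_symbol_star_vm has_symbol_star_mm A_symbol) blast+
  moreover have "has_symbol (- 1 + - 1) (\<lambda>t. ul_a (At t) w v 0 * ul_a (At t) w v 0)
      (sl_alpha I A w v 0 \<star> sl_alpha I A w v 0)"
    by (intro has_symbol_star alpha_symbol w_symbol_0 v_symbol_0)
  ultimately have "has_symbol (- 2) (\<lambda>t. rowcol (ul_w (At t) w v 0 v* (At t ** At t)) (ul_v (At t) w v 0)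
      - ul_a (At t) w v 0 * ul_a (At t) w v 0) (sl_beta I A w v (Suc 0))"
    unfolding sl_beta.simps(2) by (intro has_symbol_diff) simp_all
  moreover have "rowcol (ul_w M w v 0 v* (M ** M)) (ul_v M w v 0) - ul_a M w v 0 * ul_a M w v 0
      = ul_b M w v (Suc 0)" for M
  proof -
    have diff: "rowcol (x - c *s y) z = rowcol x z - c * rowcol y z" for x y z :: "complex^'n" and c
      by (simp add: rowcol_def sum_subtractf sum_distrib_left algebra_simps)
    have "(herm w v* M - ul_a M w v 0 *s herm w) v* M
        = herm w v* (M ** M) - ul_a M w v 0 *s (herm w v* M)"
      by (simp only: vector_matrix_mul_assoc[symmetric])
         (simp add: vec_eq_iff vector_matrix_mult_def sum_subtractf sum_distrib_left algebra_simps del: ul_a.simps)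
    moreover have "rowcol (herm w v* M) v = ul_a M w v 0"
      by simp
    ultimately show ?thesis
      unfolding ul_b.simps(2) ul_w.simps(1,2) ul_v.simps(1) by (simp only: diff)
  qed
  ultimately show ?thesis
    by simp
qed

lemma w_symbol_SucSuc:
  assumes "w_symbol m" "w_symbol (Suc m)" "v_symbol (Suc m)" "beta_symbol (Suc m)"
  shows "w_symbol (Suc (Suc m))"
proof
  fix i
  have "has_symbol (- int (Suc m) + - 1) (\<lambda>t. (ul_w (At t) w v (Suc m) v* At t) $ i)
      ((sl_w I A w v (Suc m) v\<star> A) $ i)"
    using assms by (intro has_symbol_star_vm A_symbol) blast+
  moreover have "has_symbol (- 1 + - int (Suc m))
      (\<lambda>t. (ul_a (At t) w v (Suc m) *s ul_w (At t) w v (Suc m)) $ i)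
      ((sl_alpha I A w v (Suc m) \<star>s sl_w I A w v (Suc m)) $ i)"
    using assms by (intro has_symbol_star_sv alpha_symbol) blast+
  moreover have "has_symbol (- 2 + - int m) (\<lambda>t. (ul_b (At t) w v (Suc m) *s ul_w (At t) w v m) $ i)
      ((sl_beta I A w v (Suc m) \<star>s sl_w I A w v m) $ i)"
    using assms by (intro has_symbol_star_sv) blast+
  \<comment> \<open>All three terms share one order; in the last one the order -2 of \<beta> makes
    up for the smaller index of w.\<close>
  moreover have "- int (Suc m) + - 1 = - int (Suc (Suc m))" "- 1 + - int (Suc m) = - int (Suc (Suc m))"
    "- 2 + - int m = - int (Suc (Suc m))"
    by simp_all
  ultimately show "has_symbol (- int (Suc (Suc m))) (\<lambda>t. ul_w (At t) w v (Suc (Suc m)) $ i)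
      (sl_w I A w v (Suc (Suc m)) $ i)"
    unfolding ul_w.simps(3) sl_w.simps(3) by (intro has_symbol_vec_diff) (simp_all only:)
qed

lemma beta_symbol_SucSuc:
  assumes "w_symbol (Suc (Suc m))" "v_symbol (Suc m)"
  shows "beta_symbol (Suc (Suc m))"
proof -
  have "has_symbol (- int (Suc (Suc m)) + - 1 + int (Suc m))
      (\<lambda>t. rowcol (ul_w (At t) w v (Suc (Suc m)) v* At t) (ul_v (At t) w v (Suc m)))
      ((sl_w I A w v (Suc (Suc m)) v\<star> A) v\<star>v sl_v I A w v (Suc m))"
    using assms by (intro has_symbol_star_vv has_symbol_star_vm A_symbol) blast+
  moreover have "- int (Suc (Suc m)) + - 1 + int (Suc m) = - 2"
    by simp
  ultimately show ?thesis
    unfolding ul_b.simps(2) sl_beta.simps(3) by (simp only:)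
qed

lemma v_symbol_1:
  assumes "beta_inv_symbol (Suc 0)"
  shows "v_symbol (Suc 0)"
proof
  fix i
  have "has_symbol (- 1 + 0) (\<lambda>t. (At t *v ul_v (At t) w v 0) $ r) ((A \<star>v sl_v I A w v 0) $ r)" for r
    using v0_symbol by (intro has_symbol_star_mv A_symbol) blast+
  moreover have "has_symbol (0 + - 1) (\<lambda>t. (ul_a (At t) w v 0 *s ul_v (At t) w v 0) $ r)
      ((sl_v I A w v 0 s\<star> sl_alpha I A w v 0) $ r)" for r
    using v0_symbol by (intro has_symbol_star_vs alpha_symbol w_symbol_0 v_symbol_0) blast+
  ultimately have "has_symbol (- 1) (\<lambda>t. (At t *v ul_v (At t) w v 0 - ul_a (At t) w v 0 *s ul_v (At t) w v 0) $ r)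
      ((A \<star>v sl_v I A w v 0 - sl_v I A w v 0 s\<star> sl_alpha I A w v 0) $ r)" for r
    by (intro has_symbol_vec_diff) (simp_all only: add_0_left add_0_right)
  from has_symbol_star_vs[OF this assms]
  show "has_symbol (int (Suc 0)) (\<lambda>t. ul_v (At t) w v (Suc 0) $ i) (sl_v I A w v (Suc 0) $ i)"
    unfolding ul_v.simps(2) sl_v.simps(2) by simp
qed

lemma v_symbol_SucSuc:
  assumes "v_symbol m" "v_symbol (Suc m)" "w_symbol (Suc m)" "beta_inv_symbol (Suc (Suc m))"
  shows "v_symbol (Suc (Suc m))"
proof
  fix i
  have "has_symbol (- 1 + int (Suc m)) (\<lambda>t. (At t *v ul_v (At t) w v (Suc m)) $ r)
      ((A \<star>v sl_v I A w v (Suc m)) $ r)" for r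
    using assms by (intro has_symbol_star_mv A_symbol) blast+
  moreover have "has_symbol (int (Suc m) + - 1) (\<lambda>t. (ul_a (At t) w v (Suc m) *s ul_v (At t) w v (Suc m)) $ r)
      ((sl_v I A w v (Suc m) s\<star> sl_alpha I A w v (Suc m)) $ r)" for r
    using assms by (intro has_symbol_star_vs alpha_symbol) blast+
  \<comment> \<open>The term v_m enters without a coefficient; its own order m is that of the other
    two terms.\<close>
  moreover have "- 1 + int (Suc m) = int m" "int (Suc m) + - 1 = int m"
    by simp_all
  ultimately have *: "has_symbol (int m) (\<lambda>t. (At t *v ul_v (At t) w v (Suc m)
        - ul_a (At t) w v (Suc m) *s ul_v (At t) w v (Suc m) - ul_v (At t) w v m) $ r)
      ((A \<star>v sl_v I A w v (Suc m) - sl_v I A w v (Suc m) s\<star> sl_alpha I A w v (Suc m) - sl_v I A w v m) $ r)" for r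
    using assms(1) by (intro has_symbol_vec_diff) (simp_all only:)
  have "int m + 2 = int (Suc (Suc m))"
    by simp
  with has_symbol_star_vs[OF * assms(4), of i]
  show "has_symbol (int (Suc (Suc m))) (\<lambda>t. ul_v (At t) w v (Suc (Suc m)) $ i) (sl_v I A w v (Suc (Suc m)) $ i)"
    unfolding ul_v.simps(3) sl_v.simps(3) by (simp only:)
qed

text \<open>The f j are symbols of the \<beta>_j obtained independently of the usual algorithm.
  Uniqueness identifies f (m+1) with b_(m+1), so the *-inverse of \<beta>_(m+1) has symbol
  1/b_(m+1). This gives v_(m+1), then w_(m+2), then \<beta>_(m+2): the result for \<beta> reaches
  one index beyond the hypotheses.\<close>

lemma lanczos_symbols:
  assumes "\<And>j. j \<in> {1..m} \<Longrightarrow> has_symbol (- 2) (f j) (sl_beta I A w v j)"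
    and "\<And>j. j \<in> {1..m} \<Longrightarrow> star_invertible I (sl_beta I A w v j)"
    and "\<And>j. j \<in> {1..m} \<Longrightarrow> \<exists>t\<in>I. f j t \<noteq> 0"
  shows "(\<forall>j\<le>m. v_symbol j) \<and> w_symbol m \<and> w_symbol (Suc m) \<and> beta_symbol (Suc m)"
  using assms
proof (induction m)
  case 0
  show ?case
    using v_symbol_0 w_symbol_0 w_symbol_1 beta_symbol_1 by blast
next
  case (Suc m)
  have IH: "\<forall>j\<le>m. v_symbol j" "w_symbol m" "w_symbol (Suc m)" "beta_symbol (Suc m)"
    using Suc.IH Suc.prems by (simp_all del: sl_beta.simps ul_b.simps)
  have f: "has_symbol (- 2) (f (Suc m)) (sl_beta I A w v (Suc m))"
    and inv: "star_invertible I (sl_beta I A w v (Suc m))" and nz: "\<exists>t\<in>I. f (Suc m) t \<noteq> 0"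
    using Suc.prems by simp_all
  have "f (Suc m) t = ul_b (At t) w v (Suc m)" if "t \<in> I" for t
    using has_symbol_unique[OF f IH(4) that] .
  then have inv_symbol: "beta_inv_symbol (Suc m)"
    by (intro has_symbol_cong[OF star_inv_has_symbol(2)[OF f inv nz]]) (simp only:)
  have v_Suc: "v_symbol (Suc m)"
  proof (cases m)
    case 0
    show ?thesis
      unfolding 0 by (rule v_symbol_1) (rule inv_symbol[unfolded 0])
  next
    case (Suc k)
    have "v_symbol k" "v_symbol (Suc k)"
      using IH(1)[rule_format, of k] IH(1)[rule_format, of "Suc k"] unfolding Suc by auto
    then show ?thesis
      unfolding Suc using IH(2) inv_symbol unfolding Suc by (rule v_symbol_SucSuc)
  qed
  have w_Suc: "w_symbol (Suc (Suc m))"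
    using IH(2,3) v_Suc IH(4) by (rule w_symbol_SucSuc)
  have "beta_symbol (Suc (Suc m))"
    using w_Suc v_Suc by (rule beta_symbol_SucSuc)
  moreover have "\<forall>j\<le>Suc m. v_symbol j"
    unfolding le_Suc_eq using IH(1) v_Suc by blast
  ultimately show ?case
    using IH(3) w_Suc by blast
qed

end

section \<open>Equivalence of the three nonvanishing conditions\<close>

theorem lemma2p1:
  fixes I :: "real set"
    and At :: "real \<Rightarrow> complex^'n^'n"
    and w v :: "complex^'n"
    and n :: nat
    and bt :: "nat \<Rightarrow> real \<Rightarrow> real \<Rightarrow> complex"
  assumes "is_interval I" and "\<exists>a\<in>I. \<exists>b\<in>I. a < b"
    and "\<And>i j. smooth1 I (\<lambda>t. At t $ i $ j)"
    and "rowcol (herm w) v = 1"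
    and "n \<ge> 1"
    and "star_lanczos_runs I (theta_matrix I At) w v n"
    and "\<And>j. j \<in> {1..n-1} \<Longrightarrow> sl_alpha I (theta_matrix I At) w v (j - 1) \<in> Sm_Theta I"
    and "\<And>j. j \<in> {1..n-1} \<Longrightarrow> smooth2 I (bt j) \<and> sl_beta I (theta_matrix I At) w v j = theta_distr I (bt j)"
    and "\<And>j t. j \<in> {1..n-1} \<Longrightarrow> t \<in> I \<Longrightarrow> bt j t t = 0"
  shows "((\<forall>j\<in>{1..n-1}. \<exists>t\<in>I. deriv10 I (bt j) t t \<noteq> 0) \<longleftrightarrow>
          (\<forall>j\<in>{1..n-1}. \<exists>t\<in>I. deriv01 I (bt j) t t \<noteq> 0)) \<and>
         ((\<forall>j\<in>{1..n-1}. \<exists>t\<in>I. deriv01 I (bt j) t t \<noteq> 0) \<longleftrightarrow>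
          (\<exists>\<rho>\<in>I. no_lanczos_breakdown (At \<rho>) w v (n - 1)))"
proof -
  interpret lanczos I At w v
    using assms(1-3) by unfold_locales
  define f where "f = (\<lambda>j t. - deriv01 I (bt j) t t)"
  let ?N = "\<lambda>j. \<exists>t\<in>I. f j t \<noteq> 0"
  have f: "has_symbol (- 2) (f j) (sl_beta I A w v j)" if "j \<in> {1..n-1}" for j
    using has_symbol_theta_distr_zero_diag[of "bt j"] assms(8,9)[OF that] by (simp add: f_def)
  have inv: "star_invertible I (sl_beta I A w v j)" if "j \<in> {1..n-1}" for j
    using assms(6) that by (simp add: star_lanczos_runs_def)
  have nonzero: "f j t \<noteq> 0" if "j \<in> {1..n-1}" "?N j" "t \<in> I" for j t
    using star_inv_has_symbol(1)[OF f inv] that by blast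
  \<comment> \<open>The coefficient b_j involves only the inverses of the earlier ones, so the
    identity holds at j even if f j vanishes identically.\<close>
  have b_eq: "ul_b (At t) w v j = f j t"
    if j: "j \<in> {1..n-1}" and "\<forall>i\<in>{1..<j}. ?N i" and t: "t \<in> I" for j t
  proof -
    obtain m where m: "j = Suc m"
      using j by (cases j) auto
    have "has_symbol (- 2) (\<lambda>t. ul_b (At t) w v (Suc m)) (sl_beta I A w v (Suc m))"
      using lanczos_symbols[of m f] f inv that m by (simp del: sl_beta.simps ul_b.simps)
    then show ?thesis
      using has_symbol_unique[OF _ f[OF j] t] m by blast
  qed
  have "deriv10 I (bt j) t t = f j t" if "j \<in> {1..n-1}" "t \<in> I" for j t
    using deriv10_add_deriv01_zero_diag[of "bt j" t] assms(8,9) that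
    by (auto simp: f_def eq_neg_iff_add_eq_0)
  then have one_iff: "(\<forall>j\<in>{1..n-1}. \<exists>t\<in>I. deriv10 I (bt j) t t \<noteq> 0) \<longleftrightarrow> (\<forall>j\<in>{1..n-1}. ?N j)"
    by (metis (no_types, lifting))
  have two_iff: "(\<forall>j\<in>{1..n-1}. \<exists>t\<in>I. deriv01 I (bt j) t t \<noteq> 0) \<longleftrightarrow> (\<forall>j\<in>{1..n-1}. ?N j)"
    by (simp add: f_def)
  have three_iff: "(\<exists>\<rho>\<in>I. no_lanczos_breakdown (At \<rho>) w v (n - 1)) \<longleftrightarrow> (\<forall>j\<in>{1..n-1}. ?N j)"
  proof
    assume "\<exists>\<rho>\<in>I. no_lanczos_breakdown (At \<rho>) w v (n - 1)"
    then obtain \<rho> where \<rho>: "\<rho> \<in> I" "\<And>j. j \<in> {1..n-1} \<Longrightarrow> ul_b (At \<rho>) w v j \<noteq> 0"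
      unfolding no_lanczos_breakdown_def by blast
    \<comment> \<open>Strong induction: once the earlier f i are not identically 0, f j at \<rho>
      equals the nonzero b_j.\<close>
    have "j \<in> {1..n-1} \<Longrightarrow> ?N j" for j
    proof (induction j rule: less_induct)
      case (less j)
      then have "\<forall>i\<in>{1..<j}. ?N i"
        by simp
      then show ?case
        using b_eq[OF less.prems _ \<rho>(1)] \<rho> less.prems by metis
    qed
    then show "\<forall>j\<in>{1..n-1}. ?N j"
      by blast
  next
    assume N: "\<forall>j\<in>{1..n-1}. ?N j"
    \<comment> \<open>Any point of I will do: *-invertibility leaves no zeros to an f j that is not
      identically 0.\<close>
    obtain \<rho> where \<rho>: "\<rho> \<in> I"
      using assms(2) by blast
    have "ul_b (At \<rho>) w v j \<noteq> 0" if j: "j \<in> {1..n-1}" for j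
    proof -
      have "\<forall>i\<in>{1..<j}. ?N i"
        using N j by simp
      then show ?thesis
        using b_eq[OF j _ \<rho>] nonzero[OF j _ \<rho>] N j by metis
    qed
    then show "\<exists>\<rho>\<in>I. no_lanczos_breakdown (At \<rho>) w v (n - 1)"
      using \<rho> unfolding no_lanczos_breakdown_def by blast
  qed
  show ?thesis
    using one_iff two_iff three_iff by blast
qed

end
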